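(* There exists $n_0$ such that for every integer $n \ge n_0$ we have $M(n,n-1) \ge n^{1.0797}$.
   Context: For permutations $\sigma,\tau$ of $[n]=\{1,\dots,n\}$, the Hamming distance $d(\sigma,\tau)$ is the number of $x\in[n]$ with $\sigma(x)\neq\tau(x)$. A permutation code PC$(n,d)$ is a subset $\Gamma$ of the symmetric group $\mathcal{S}_n$ such that any two distinct elements of $\Gamma$ are at Hamming distance at least $d$. $M(n,d)$ denotes the maximum size of a PC$(n,d)$. *)

theory Defs
  imports Complex_Main "HOL-Combinatorics.Permutations"
begin

definition hamming :: "nat \<Rightarrow> (nat \<Rightarrow> nat) \<Rightarrow> (nat \<Rightarrow> nat) \<Rightarrow> nat" where
  "hamming n \<sigma> \<tau> = card {x \<in> {1..n}. \<sigma> x \<noteq> \<tau> x}"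

(* An element of the symmetric group on {1..n} is a function with "permutes {1..n}": it is
   the identity outside {1..n}, so it is determined by its values on {1..n}. *)
definition perm_code :: "nat \<Rightarrow> nat \<Rightarrow> (nat \<Rightarrow> nat) set \<Rightarrow> bool" where
  "perm_code n d \<Gamma> \<longleftrightarrow>
     \<Gamma> \<subseteq> {\<sigma>. \<sigma> permutes {1..n}} \<and>
     (\<forall>\<sigma>\<in>\<Gamma>. \<forall>\<tau>\<in>\<Gamma>. \<sigma> \<noteq> \<tau> \<longrightarrow> d \<le> hamming n \<sigma> \<tau>)"

definition max_code_size :: "nat \<Rightarrow> nat \<Rightarrow> nat" where
  "max_code_size n d = Max (card ` {\<Gamma>. perm_code n d \<Gamma>})"

lemma finite_perm_codes: "finite {\<Gamma>. perm_code n d \<Gamma>}"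
proof (rule finite_subset)
  show "{\<Gamma>. perm_code n d \<Gamma>} \<subseteq> Pow {\<sigma>. \<sigma> permutes {1..n}}"
    by (auto simp: perm_code_def)
  show "finite (Pow {\<sigma>. \<sigma> permutes {1..n}})"
    by (simp add: finite_permutations)
qed

lemma perm_code_empty: "perm_code n d {}"
  by (simp add: perm_code_def)

(* The set of sizes is finite and nonempty, so Max is an attained maximum. *)
lemma max_code_size_attained:
  "\<exists>\<Gamma>. perm_code n d \<Gamma> \<and> finite \<Gamma> \<and> card \<Gamma> = max_code_size n d"
proof -
  have "max_code_size n d \<in> card ` {\<Gamma>. perm_code n d \<Gamma>}"
    unfolding max_code_size_def
    by (rule Max_in, use finite_perm_codes in blast, use perm_code_empty in blast)
  then obtain \<Gamma> where \<Gamma>: "perm_code n d \<Gamma>" "card \<Gamma> = max_code_size n d"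
    by auto
  moreover have "finite \<Gamma>"
    using \<Gamma>(1) finite_subset[OF _ finite_permutations[of "{1..n}"]]
    by (auto simp: perm_code_def)
  ultimately show ?thesis by blast
qed

lemma card_le_max_code_size:
  "perm_code n d \<Gamma> \<Longrightarrow> card \<Gamma> \<le> max_code_size n d"
  unfolding max_code_size_def by (rule Max_ge) (use finite_perm_codes in auto)

end

theory Submission
  imports Defs "HOL-Number_Theory.Number_Theory" "HOL-Real_Asymp.Real_Asymp"
begin

text \<open>
  Let $q$ be prime and $n = q^2 t + j$ with $0 \le j \le t$, where every prime factor of $t$ exceeds $q$.
  On $A = (\mathbb{Z}/q)^2 \times \mathbb{Z}/t$ the affine maps with scalar linear part
  $a \in \{1, \dots, q - 2\}$ agree pairwise in at most one point. Each of them is extended to $j$ new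
  points: the $l$-th new point is inserted into the arrow $x_l \mapsto \sigma(x_l)$. The points $x_l$ lie on
  a line whose base point encodes $a$ and one half of the translation part, while the images
  $\sigma(x_l)$ encode $a$ and the other half; hence two distinct extended maps still agree in at most one
  point, and $M(n, n-1) \ge (q-2) q^2 t$.

  For large $n$ there is a prime $q$ between $n^{0.08}$ and $n^{0.083}$ by Mertens' first theorem.
  A suitable $t$ is an integer without prime factors up to $q$ in the interval
  $(n/(q^2+1), n/q^2]$. Its length exceeds $q^8$, so the Brun--Hooley lower bound sieve provides one:
  the primes up to $z$ are cut at the points $z^{(4/9)^j}$ and the inclusion-exclusion over the $j$-th range
  is truncated after $2(j+1)$ primes, which costs a level of $z^{6.48}$ in total.
\<close>

section \<open>Extending a family of bijections by new points\<close>

text \<open>Affine maps on the integers modulo n agree at most once only if the differences of their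
  scalars are units, which small prime factors of n forbid. Writing n = q^2 t + j moves this demand
  to q and t; the price is j inserted points, which must fit into the same budget of one agreement
  per pair. The code has at least (q - 2) n / 2 elements, so the exponent depends on how large q may
  be. The condition 0 \<le> j \<le> t confines t to an interval of length about n / q^4. A sieve
  that succeeds on intervals of length q^8 therefore needs n to exceed about q^12, which puts the
  barrier for q at n^(1/12) = n^0.0833...; the exponent 0.083 lies just below it. The gap down to
  0.08 is room for a prime: Mertens' theorem with a bounded error only finds primes in intervals
  whose endpoints have a ratio above e^8.\<close>

lemma card_le_max_code_sizeI:
  fixes f :: "'i \<Rightarrow> 'a \<Rightarrow> 'a"
  assumes "finite S" "card S \<ge> 2" "finite I"
    and bij: "\<And>i. i \<in> I \<Longrightarrow> bij_betw (f i) S S"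
    and agree: "\<And>i k. i \<in> I \<Longrightarrow> k \<in> I \<Longrightarrow> i \<noteq> k \<Longrightarrow> card {v\<in>S. f i v = f k v} \<le> 1"
  shows "card I \<le> max_code_size (card S) (card S - 1)"
proof -
  define n where "n = card S"
  obtain h where h: "bij_betw h {1..n} S"
    using \<open>finite S\<close> unfolding n_def by (metis bij_betw_iff_card card_atLeastAtMost diff_Suc_1 finite_atLeastAtMost)
  define g where "g = inv_into {1..n} h"
  have g: "bij_betw g S {1..n}"
    unfolding g_def by (rule bij_betw_inv_into[OF h])
  have gh: "g (h x) = x" if "x \<in> {1..n}" for x
    using that h by (simp add: g_def bij_betw_inv_into_left)
  have g_inj: "g x = g y \<longleftrightarrow> x = y" if "x \<in> S" "y \<in> S" for x y
    using that g by (meson bij_betw_imp_inj_on inj_on_eq_iff)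
  define P where "P i = (\<lambda>x. if x \<in> {1..n} then g (f i (h x)) else x)" for i
  have perm: "P i permutes {1..n}" if "i \<in> I" for i
  proof (rule bij_imp_permutes)
    have "bij_betw (g \<circ> f i \<circ> h) {1..n} {1..n}"
      using h g bij[OF that] bij_betw_trans by (metis comp_assoc)
    then show "bij_betw (P i) {1..n} {1..n}"
      by (rule bij_betw_cong[THEN iffD1, rotated]) (simp add: P_def)
  qed (simp only: P_def if_False)
  have hS: "h x \<in> S" if "x \<in> {1..n}" for x
    using that h by (meson bij_betwE)
  have fS: "f i x \<in> S" if "x \<in> S" "i \<in> I" for i x
    using that bij by (meson bij_betwE)
  have agreeP: "card {x\<in>{1..n}. P i x = P k x} \<le> 1" if "i \<in> I" "k \<in> I" "i \<noteq> k" for i k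
  proof -
    have "card {x\<in>{1..n}. P i x = P k x} \<le> card {v\<in>S. f i v = f k v}"
    proof (rule card_inj_on_le[where f = h])
      show "inj_on h {x \<in> {1..n}. P i x = P k x}"
        by (rule inj_on_subset[OF bij_betw_imp_inj_on[OF h]]) auto
      show "h ` {x \<in> {1..n}. P i x = P k x} \<subseteq> {v \<in> S. f i v = f k v}"
        using that hS fS by (auto simp: P_def g_inj)
    qed (use \<open>finite S\<close> in auto)
    with agree[OF that] show ?thesis by linarith
  qed
  have ham: "n - 1 \<le> hamming n (P i) (P k)" if "i \<in> I" "k \<in> I" "i \<noteq> k" for i k
  proof -
    have "{x\<in>{1..n}. P i x = P k x} \<union> {x\<in>{1..n}. P i x \<noteq> P k x} = {1..n}" by auto
    then have "n \<le> card {x\<in>{1..n}. P i x = P k x} + card {x\<in>{1..n}. P i x \<noteq> P k x}"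
      using card_Un_le[of "{x\<in>{1..n}. P i x = P k x}" "{x\<in>{1..n}. P i x \<noteq> P k x}"] by simp
    with agreeP[OF that] show ?thesis unfolding hamming_def by linarith
  qed
  \<comment> \<open>Equal permutations would have distance 0, which is below n - 1 because n \<ge>
    2. Hence distinct indices give distinct codewords.\<close>
  have "inj_on P I"
  proof (rule inj_onI, rule ccontr)
    fix i k assume "i \<in> I" "k \<in> I" "P i = P k" "i \<noteq> k"
    with ham[of i k] have "n - 1 \<le> 0" by (simp add: hamming_def)
    then show False using assms(2) n_def by simp
  qed
  then have "card I = card (P ` I)" by (simp add: card_image)
  also have "perm_code n (n - 1) (P ` I)"
    unfolding perm_code_def using perm ham by (auto)
  then have "card (P ` I) \<le> max_code_size n (n - 1)"
    by (rule card_le_max_code_size)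
  finally show ?thesis by (simp add: n_def)
qed

definition reroute :: "nat \<Rightarrow> ('a \<Rightarrow> 'a) \<Rightarrow> (nat \<Rightarrow> 'a) \<Rightarrow> 'a + nat \<Rightarrow> 'a + nat" where
  "reroute j \<sigma> x = case_sum
     (\<lambda>v. if v \<in> x ` {..<j} then Inr (inv_into {..<j} x v) else Inl (\<sigma> v)) (\<lambda>l. Inl (\<sigma> (x l)))"

lemma reroute_simps:
  assumes "inj_on x {..<j}"
  shows "l < j \<Longrightarrow> reroute j \<sigma> x (Inl (x l)) = Inr l"
    and "v \<notin> x ` {..<j} \<Longrightarrow> reroute j \<sigma> x (Inl v) = Inl (\<sigma> v)"
    and "reroute j \<sigma> x (Inr l) = Inl (\<sigma> (x l))"
  using assms by (auto simp: reroute_def)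

lemma bij_betw_reroute:
  assumes "bij_betw \<sigma> A A" "inj_on x {..<j}" "x ` {..<j} \<subseteq> A"
  shows "bij_betw (reroute j \<sigma> x) (A <+> {..<j}) (A <+> {..<j})"
proof (rule bij_betw_byWitness[where f' = "\<lambda>w. case w of
      Inl u \<Rightarrow> (let v = inv_into A \<sigma> u in if v \<in> x ` {..<j} then Inr (inv_into {..<j} x v) else Inl v)
    | Inr l \<Rightarrow> Inl (x l)"])
  note simps = reroute_simps[OF assms(2)]
  have left: "inv_into A \<sigma> (\<sigma> v) = v" if "v \<in> A" for v
    using that assms(1) by (simp add: bij_betw_inv_into_left)
  have xA: "x l \<in> A" if "l < j" for l using that assms(3) by auto
  have xleft: "inv_into {..<j} x (x l) = l" if "l < j" for l
    using that assms(2) by simp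
  have sA: "\<sigma> v \<in> A" if "v \<in> A" for v using that assms(1) by (meson bij_betwE)
  show "\<forall>a\<in>A <+> {..<j}. (case reroute j \<sigma> x a of
      Inl u \<Rightarrow> (let v = inv_into A \<sigma> u in if v \<in> x ` {..<j} then Inr (inv_into {..<j} x v) else Inl v)
    | Inr l \<Rightarrow> Inl (x l)) = a"
  proof
    fix a assume "a \<in> A <+> {..<j}"
    then consider (v) v where "a = Inl v" "v \<in> A" "v \<notin> x ` {..<j}"
      | (x) l where "a = Inl (x l)" "l < j" | (l) l where "a = Inr l" "l < j"
      by fastforce
    then show "(case reroute j \<sigma> x a of
      Inl u \<Rightarrow> (let v = inv_into A \<sigma> u in if v \<in> x ` {..<j} then Inr (inv_into {..<j} x v) else Inl v)
    | Inr l \<Rightarrow> Inl (x l)) = a"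
      by cases (auto simp: simps left xA xleft)
  qed
  have right: "\<sigma> (inv_into A \<sigma> u) = u" if "u \<in> A" for u
    using that assms(1) by (simp add: bij_betw_inv_into_right)
  have invA: "inv_into A \<sigma> u \<in> A" if "u \<in> A" for u
    using that assms(1) by (metis bij_betw_def inv_into_into)
  show "\<forall>a'\<in>A <+> {..<j}. reroute j \<sigma> x (case a' of
      Inl u \<Rightarrow> (let v = inv_into A \<sigma> u in if v \<in> x ` {..<j} then Inr (inv_into {..<j} x v) else Inl v)
    | Inr l \<Rightarrow> Inl (x l)) = a'"
    by (auto simp: simps Let_def right f_inv_into_f)
  show "reroute j \<sigma> x ` (A <+> {..<j}) \<subseteq> A <+> {..<j}"
    using xA sA by (auto simp: reroute_def intro!: inv_into_into[of _ x "{..<j}", simplified])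
  show "(\<lambda>w. case w of
      Inl u \<Rightarrow> (let v = inv_into A \<sigma> u in if v \<in> x ` {..<j} then Inr (inv_into {..<j} x v) else Inl v)
    | Inr l \<Rightarrow> Inl (x l)) ` (A <+> {..<j}) \<subseteq> A <+> {..<j}"
    using xA invA by (auto simp: Let_def intro!: inv_into_into[of _ x "{..<j}", simplified])
qed

text \<open>Every agreement is charged to one of three sources. An old point \<open>x l\<close> is
  sent to the new point \<open>l\<close>, which the other map does only to \<open>y l\<close>. A new
  point agrees only if the two cut arrows end in the same place. Any other old point keeps its image
  under \<open>\<sigma>\<close>, so an agreement there forces it off all \<open>y l\<close> as well
  and is an agreement of \<open>\<sigma>\<close> and \<open>\<tau>\<close>.\<close>

lemma reroute_agreement:
  assumes "finite A" "inj_on x {..<j}" "inj_on y {..<j}"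
  shows "card {w \<in> A <+> {..<j}. reroute j \<sigma> x w = reroute j \<tau> y w} \<le>
    card {v\<in>A. \<sigma> v = \<tau> v} + card {l. l < j \<and> x l = y l} + card {l. l < j \<and> \<sigma> (x l) = \<tau> (y l)}"
    (is "card ?W \<le> card ?V + card ?X + card ?Y")
proof -
  have "?W \<subseteq> Inl ` ?V \<union> (Inl \<circ> x) ` ?X \<union> Inr ` ?Y"
  proof
    fix w assume w: "w \<in> ?W"
    show "w \<in> Inl ` ?V \<union> (Inl \<circ> x) ` ?X \<union> Inr ` ?Y"
    proof (cases w)
      case (Inr l)
      with w show ?thesis by (auto simp: reroute_def)
    next
      case (Inl v)
      show ?thesis
      proof (cases "v \<in> x ` {..<j}")
        case True
        then obtain l where l: "l < j" "v = x l" by auto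
        with w Inl have "reroute j \<tau> y (Inl v) = Inr l"
          by (simp add: reroute_simps(1)[OF assms(2)])
        then have "v = y l"
          by (auto simp: reroute_def f_inv_into_f split: if_splits)
        with l Inl have "w = (Inl \<circ> x) l" "l \<in> ?X" by auto
        then show ?thesis by blast
      next
        case False
        with w Inl have "reroute j \<tau> y (Inl v) = Inl (\<sigma> v)"
          by (simp add: reroute_simps(2)[OF assms(2)])
        then have "\<tau> v = \<sigma> v"
          by (auto simp: reroute_def split: if_splits)
        with w Inl show ?thesis by auto
      qed
    qed
  qed
  then have "card ?W \<le> card (Inl ` ?V \<union> (Inl \<circ> x) ` ?X \<union> Inr ` ?Y)"
    by (rule card_mono[rotated]) (use \<open>finite A\<close> in auto)
  also have "\<dots> \<le> card (Inl ` ?V :: ('a + nat) set) + card ((Inl \<circ> x) ` ?X :: ('a + nat) set) + card (Inr ` ?Y :: ('a + nat) set)"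
    by (rule order_trans[OF card_Un_le], rule add_right_mono, rule card_Un_le)
  also have "\<dots> \<le> card ?V + card ?X + card ?Y"
    by (intro add_mono card_image_le) (use \<open>finite A\<close> in auto)
  finally show ?thesis .
qed

lemma card_le_max_code_size_reroute:
  fixes \<sigma> :: "'i \<Rightarrow> 'a \<Rightarrow> 'a"
  assumes "finite A" "card A \<ge> 2" "finite I"
    and bij: "\<And>i. i \<in> I \<Longrightarrow> bij_betw (\<sigma> i) A A"
    and inj: "\<And>i. i \<in> I \<Longrightarrow> inj_on (x i) {..<j}"
    and sub: "\<And>i. i \<in> I \<Longrightarrow> x i ` {..<j} \<subseteq> A"
    and agree: "\<And>i k. i \<in> I \<Longrightarrow> k \<in> I \<Longrightarrow> i \<noteq> k \<Longrightarrow>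
      card {v\<in>A. \<sigma> i v = \<sigma> k v} + card {l. l < j \<and> x i l = x k l} +
      card {l. l < j \<and> \<sigma> i (x i l) = \<sigma> k (x k l)} \<le> 1"
  shows "card I \<le> max_code_size (card A + j) (card A + j - 1)"
proof -
  have c: "card (A <+> {..<j}) = card A + j"
    using \<open>finite A\<close> by (simp add: card_Plus)
  have "card I \<le> max_code_size (card (A <+> {..<j})) (card (A <+> {..<j}) - 1)"
  proof (rule card_le_max_code_sizeI[where f = "\<lambda>i. reroute j (\<sigma> i) (x i)"])
    fix i k assume ik: "i \<in> I" "k \<in> I" "i \<noteq> k"
    show "card {v \<in> A <+> {..<j}. reroute j (\<sigma> i) (x i) v = reroute j (\<sigma> k) (x k) v} \<le> 1"
      using reroute_agreement[OF \<open>finite A\<close> inj[OF ik(1)] inj[OF ik(2)]] agree[OF ik] le_trans by blast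
  next
    fix i assume "i \<in> I"
    then show "bij_betw (reroute j (\<sigma> i) (x i)) (A <+> {..<j}) (A <+> {..<j})"
      by (intro bij_betw_reroute bij inj sub)
  qed (use assms(1-3) c in auto)
  then show ?thesis by (simp add: c)
qed

section \<open>An explicit code\<close>

lemma mod_linear_eqD:
  fixes m k v v' c :: int
  assumes "(k * v + c) mod m = (k * v' + c) mod m" "coprime k m" "0 \<le> v" "v < m" "0 \<le> v'" "v' < m"
  shows "v = v'"
proof -
  have "m dvd (k * v + c) - (k * v' + c)"
    using assms(1) by (simp add: mod_eq_dvd_iff)
  then have "m dvd k * (v - v')"
    by (simp add: algebra_simps)
  then have "m dvd v - v'"
    using assms(2) by (simp add: coprime_commute coprime_dvd_mult_right_iff)
  then have "v mod m = v' mod m" by (simp add: mod_eq_dvd_iff)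
  then show ?thesis using assms(3-6) by simp
qed

text \<open>Subtracting the two congruences cancels the offsets and leaves
  \<open>(k - k') * (v - v')\<close> divisible by \<open>m\<close>: lines whose slopes differ by a
  unit cross at most once.\<close>

lemma mod_linear_unique:
  fixes m k k' v v' c c' :: int
  assumes "(k * v + c) mod m = (k' * v + c') mod m" "(k * v' + c) mod m = (k' * v' + c') mod m"
    "coprime (k - k') m" "0 \<le> v" "v < m" "0 \<le> v'" "v' < m"
  shows "v = v'"
proof -
  have "m dvd ((k * v + c) - (k' * v + c')) - ((k * v' + c) - (k' * v' + c'))"
    using assms(1,2) unfolding mod_eq_dvd_iff by (rule dvd_diff)
  then have "m dvd (k - k') * (v - v')"
    by (simp add: algebra_simps)
  then have "m dvd v - v'"
    using assms(3) by (simp add: coprime_commute coprime_dvd_mult_right_iff)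
  then have "v mod m = v' mod m" by (simp add: mod_eq_dvd_iff)
  then show ?thesis using assms(4-7) by simp
qed

lemma mod_linear_solvable:
  fixes k c d m :: int
  assumes "coprime k m" "m > 0"
  obtains v where "0 \<le> v" "v < m" "(k * v + c) mod m = d mod m"
proof -
  obtain u where u: "[k * u = 1] (mod m)"
    using assms(1) cong_solve_coprime_int by blast
  let ?v = "u * (d - c)"
  have "(k * (?v mod m) + c) mod m = (k * ?v + c) mod m"
    by (rule mod_add_cong) (simp_all add: mod_mult_right_eq)
  also have "(k * ?v) mod m = (1 * (d - c)) mod m"
    using cong_scalar_right[OF u, of "d - c"] unfolding unique_euclidean_semiring_class.cong_def by (simp only: mult.assoc)
  then have "(k * ?v + c) mod m = (1 * (d - c) + c) mod m"
    by (rule mod_add_cong) (rule refl)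
  finally have "(k * (?v mod m) + c) mod m = d mod m" by simp
  then show ?thesis
    using that[of "(u * (d - c)) mod m"] \<open>m > 0\<close> by simp
qed

lemma bij_betw_mod_linear:
  fixes k c m :: int
  assumes "coprime k m" "m > 0"
  shows "bij_betw (\<lambda>v. (k * v + c) mod m) {0..<m} {0..<m}"
proof (rule bij_betwI')
  fix v v' assume "v \<in> {0..<m}" "v' \<in> {0..<m}"
  then show "(k * v + c) mod m = (k * v' + c) mod m \<longleftrightarrow> v = v'"
    using mod_linear_eqD[of k v c m v'] assms(1) by auto
next
  fix d assume "d \<in> {0..<m}"
  then show "\<exists>v\<in>{0..<m}. d = (k * v + c) mod m"
    using mod_linear_solvable[OF assms, of c d] by (metis atLeastLessThan_iff mod_pos_pos_trivial)
qed (use assms(2) in auto)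

lemma card_le_oneI: "finite S \<Longrightarrow> (\<And>x y. x \<in> S \<Longrightarrow> y \<in> S \<Longrightarrow> x = y) \<Longrightarrow> card S \<le> 1"
  using card_le_Suc0_iff_eq[of S] by auto

lemma coprime_int_small_prime:
  fixes k :: int
  assumes "prime (q::nat)" "0 < \<bar>k\<bar>" "\<bar>k\<bar> < int q"
  shows "coprime k (int q)"
proof -
  have "\<not> int q dvd k" using assms(2,3) zdvd_imp_le[of "int q" "\<bar>k\<bar>"] by auto
  then show ?thesis
    using assms(1) by (metis coprime_commute prime_imp_coprime prime_int_nat_transfer nat_int prime_ge_0_int prime_nat_int_transfer)
qed

lemma coprime_int_rough:
  fixes k :: int
  assumes rough: "\<And>p. prime p \<Longrightarrow> p dvd t \<Longrightarrow> p > (q::nat)" and "0 < \<bar>k\<bar>" "\<bar>k\<bar> \<le> int q"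
  shows "coprime k (int t)"
proof (rule ccontr)
  assume "\<not> coprime k (int t)"
  then have "\<not> coprime (nat \<bar>k\<bar>) t"
    by (metis coprime_abs_left_iff coprime_int_iff int_nat_eq abs_ge_zero)
  then obtain p where p: "prime p" "p dvd nat \<bar>k\<bar>" "p dvd t"
    by (metis coprime_iff_gcd_eq_1 gcd_greatest_iff prime_factor_nat gcd_nat.refl)
  then have "p \<le> nat \<bar>k\<bar>" using assms(2) by (intro dvd_imp_le) auto
  with rough[OF p(1,3)] assms(3) show False by linarith
qed

text \<open>How two maps differ decides where their one agreement can be. If \<open>a\<close>
  differs, the affine maps agree at most once, and neither the cut points nor their images coincide,
  since both display \<open>a\<close>. If \<open>a\<close> is the same, distinct affine maps never
  agree; a common cut point forces equal \<open>b'\<close> and a common image forces equal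
  \<open>b\<close>. So when \<open>(b, b')\<close> differs only one of the two sources survives, and
  there the slopes differ, which leaves one coincidence. When only \<open>c\<close> differs, the
  lines are parallel and disjoint.\<close>

theorem max_code_size_ge_of_rough:
  fixes q t j :: nat
  assumes q: "prime q" and t: "t > 0" and rough: "\<And>p. prime p \<Longrightarrow> p dvd t \<Longrightarrow> p > q" and j: "j \<le> t"
  shows "(q - 2) * (q * q * t) \<le> max_code_size (q * q * t + j) (q * q * t + j - 1)"
proof -
  define Q where "Q = int q"
  define T where "T = int t"
  define A where "A = {0..<Q} \<times> {0..<Q} \<times> {0..<T}"
  define I where "I = {1..<Q - 1} \<times> A"
  have q2: "q \<ge> 2" using q prime_ge_2_nat by blast
  have Q: "Q > 1" "T > 0" using q2 t by (auto simp: Q_def T_def)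
  have cardA: "card A = q * q * t" by (simp add: A_def Q_def T_def card_cartesian_product)
  have "nat (int q - 2) = q - 2" by linarith
  then have cardI: "card I = (q - 2) * (q * q * t)"
    unfolding I_def card_cartesian_product cardA by (simp add: Q_def)
  have copQ: "coprime k Q" if "0 < \<bar>k\<bar>" "\<bar>k\<bar> < Q" for k
    using coprime_int_small_prime[OF q] that unfolding Q_def by blast
  have copT: "coprime k T" if "0 < \<bar>k\<bar>" "\<bar>k\<bar> \<le> Q" for k
    using coprime_int_rough[OF rough] that unfolding Q_def T_def by blast
  have "\<forall>a b. \<exists>v. a \<in> {1..<Q} \<longrightarrow> 0 \<le> v \<and> v < Q \<and> (a * v + b) mod Q = a mod Q"
    using mod_linear_solvable[of _ Q _ "_ :: int"] copQ Q(1)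
    by (metis (no_types, opaque_lifting) abs_of_pos atLeastLessThan_iff less_le_trans order_less_trans zero_less_one)
  then obtain g where g: "\<And>a b. a \<in> {1..<Q} \<Longrightarrow> 0 \<le> g a b \<and> g a b < Q \<and> (a * g a b + b) mod Q = a mod Q"
    by metis
  \<comment> \<open>the slopes \<open>s b b'\<close> are units modulo \<open>T\<close>, and so is the difference of two slopes whenever exactly
    one of the two arguments changes\<close>
  define s where "s b b' = (b + b') mod Q + 1" for b b' :: int
  have "0 \<le> r mod Q" "r mod Q < Q" for r
    using Q(1) by simp_all
  then have s: "1 \<le> s b b'" "s b b' \<le> Q" for b b'
    unfolding s_def by (simp_all add: add_increasing int_one_le_iff_zero_less zless_imp_add1_zle)
  define \<sigma> where "\<sigma> = (\<lambda>(a, b, b', c) (u, u', v). ((a * u + b) mod Q, (a * u' + b') mod Q, (a * v + c) mod T))"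
  \<comment> \<open>The point displays \<open>a\<close> and, through \<open>g a b'\<close>, also
    \<open>b'\<close>. The equation defining \<open>g\<close> makes the second coordinate of the
    image equal to \<open>a\<close>, so the image displays \<open>a\<close> and, through
    \<open>a * a + b\<close>, also \<open>b\<close>.\<close>
  define x where "x = (\<lambda>(a, b, b', c) (l::nat). (a, g a b', (s b b' * int l + c) mod T))"
  have \<sigma>x: "\<sigma> (a, b, b', c) (x (a, b, b', c) l) =
      ((a * a + b) mod Q, a, (a * s b b' * int l + (a + 1) * c) mod T)" if "a \<in> {1..<Q - 1}" for a b b' c l
  proof -
    have "(a * g a b' + b') mod Q = a" using g[of a b'] that by simp
    moreover have "(a * ((s b b' * int l + c) mod T) + c) mod T = (a * (s b b' * int l + c) + c) mod T"
      by (rule mod_add_cong) (simp_all add: mod_mult_right_eq)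
    then have "(a * ((s b b' * int l + c) mod T) + c) mod T = (a * s b b' * int l + (a + 1) * c) mod T"
      by (simp add: algebra_simps)
    ultimately show ?thesis by (simp add: \<sigma>_def x_def)
  qed
  have "card I \<le> max_code_size (card A + j) (card A + j - 1)"
  proof (rule card_le_max_code_size_reroute[where \<sigma> = \<sigma> and x = x])
    show "finite A" "finite I" by (simp_all add: A_def I_def)
    have "2 * 1 * 1 \<le> q * q * t" by (intro mult_le_mono) (use q2 t in auto)
    then show "card A \<ge> 2" unfolding cardA by simp
  next
    fix i assume "i \<in> I"
    then obtain a b b' c where i: "i = (a, b, b', c)" "a \<in> {1..<Q-1}" "b \<in> {0..<Q}" "b' \<in> {0..<Q}" "c \<in> {0..<T}"
      by (auto simp: I_def A_def)
    have "\<sigma> i = map_prod (\<lambda>u. (a * u + b) mod Q) (map_prod (\<lambda>u. (a * u + b') mod Q) (\<lambda>v. (a * v + c) mod T))"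
      by (auto simp: \<sigma>_def i(1) fun_eq_iff)
    then show "bij_betw (\<sigma> i) A A"
      unfolding A_def using i(2) Q
      by (auto intro!: bij_betw_map_prod bij_betw_mod_linear copQ copT)
    show "inj_on (x i) {..<j}"
    proof (rule inj_onI)
      fix l l' assume "l \<in> {..<j}" "l' \<in> {..<j}" "x i l = x i l'"
      \<comment> \<open>By \<open>j \<le> t\<close> distinct labels are distinct residues modulo
        \<open>T\<close>, and the slope is a unit.\<close>
      then have "int l = int l'"
        using j s[of b b']
        by (intro mod_linear_eqD[of "s b b'" "int l" c T "int l'"] copT) (auto simp: x_def i(1) T_def)
      then show "l = l'" by simp
    qed
    show "x i ` {..<j} \<subseteq> A"
      using g[of a b'] i(2) Q by (auto simp: x_def i(1) A_def)
  next
    fix i i' assume ii: "i \<in> I" "i' \<in> I" "i \<noteq> i'"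
    obtain a b b' c where i: "i = (a, b, b', c)" "a \<in> {1..<Q-1}" "b \<in> {0..<Q}" "b' \<in> {0..<Q}" "c \<in> {0..<T}"
      using ii(1) by (auto simp: I_def A_def)
    obtain d e e' f where i': "i' = (d, e, e', f)" "d \<in> {1..<Q-1}" "e \<in> {0..<Q}" "e' \<in> {0..<Q}" "f \<in> {0..<T}"
      using ii(2) by (auto simp: I_def A_def)
    let ?V = "{v \<in> A. \<sigma> i v = \<sigma> i' v}"
    let ?X = "{l. l < j \<and> x i l = x i' l}"
    let ?Y = "{l. l < j \<and> \<sigma> i (x i l) = \<sigma> i' (x i' l)}"
    have xx: "a = d \<and> b' = e' \<and> (s b b' * int l + c) mod T = (s e e' * int l + f) mod T" if "l \<in> ?X" for l
    proof -
      have *: "a = d" "g a b' = g a e'" "(s b b' * int l + c) mod T = (s e e' * int l + f) mod T"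
        using that by (auto simp: x_def i(1) i'(1))
      then have "(1 * b' + a * g a b') mod Q = (1 * e' + a * g a b') mod Q"
        using g[of a b'] g[of a e'] i(2) by (simp add: add.commute)
      then have "b' = e'" by (rule mod_linear_eqD) (use i i' in auto)
      with * show ?thesis by blast
    qed
    have yy: "a = d \<and> b = e \<and> (a * s b b' * int l + (a + 1) * c) mod T = (a * s e e' * int l + (a + 1) * f) mod T"
      if "l \<in> ?Y" for l
    proof -
      have *: "a = d" "(a * a + b) mod Q = (a * a + e) mod Q"
        "(a * s b b' * int l + (a + 1) * c) mod T = (a * s e e' * int l + (a + 1) * f) mod T"
        using that i(2) i'(2) by (auto simp: i(1) i'(1) \<sigma>x)
      then have "(1 * b + a * a) mod Q = (1 * e + a * a) mod Q" by (simp add: add.commute)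
      then have "b = e" by (rule mod_linear_eqD) (use i i' in auto)
      with * show ?thesis by blast
    qed
    have s_eq: "b = e" if "s b b' = s e b'" for b'
    proof -
      have "(1 * b + b') mod Q = (1 * e + b') mod Q" using that by (simp add: s_def)
      then show ?thesis by (rule mod_linear_eqD) (use i i' in auto)
    qed
    have s_eq': "b' = e'" if "s b b' = s b e'"
    proof -
      have "(1 * b' + b) mod Q = (1 * e' + b) mod Q" using that by (simp add: s_def add.commute)
      then show ?thesis by (rule mod_linear_eqD) (use i i' in auto)
    qed
    have s_diff: "\<bar>s b b' - s e e'\<bar> < Q" using s[of b b'] s[of e e'] by linarith
    have V: "card ?V \<le> 1" if "a \<noteq> d"
    proof (rule card_le_oneI)
      fix v w assume "v \<in> ?V" "w \<in> ?V"
      moreover obtain v1 v2 v3 w1 w2 w3 where "v = (v1, v2, v3)" "w = (w1, w2, w3)"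
        by (metis prod_cases3)
      moreover have "coprime (a - d) Q" "coprime (a - d) T"
        using that i(2) i'(2) by (auto intro!: copQ copT)
      ultimately show "v = w"
        using mod_linear_unique[of a v1 b Q d e w1] mod_linear_unique[of a v2 b' Q d e' w2]
          mod_linear_unique[of a v3 c T d f w3]
        by (auto simp: \<sigma>_def i(1) i'(1) A_def)
    qed (simp add: A_def)
    have V0: "?V = {}" if "a = d"
    proof (rule ccontr)
      assume "?V \<noteq> {}"
      then obtain u u' v where "(a * u + b) mod Q = (d * u + e) mod Q" "(a * u' + b') mod Q = (d * u' + e') mod Q"
        "(a * v + c) mod T = (d * v + f) mod T"
        by (auto simp: \<sigma>_def i(1) i'(1))
      then have "(1 * b + a * u) mod Q = (1 * e + a * u) mod Q" "(1 * b' + a * u') mod Q = (1 * e' + a * u') mod Q"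
        "(1 * c + a * v) mod T = (1 * f + a * v) mod T"
        using that by (simp_all add: add.commute)
      then have "b = e" "b' = e'" "c = f"
        using mod_linear_eqD i i' by (metis coprime_1_left atLeastLessThan_iff)+
      with ii(3) that i(1) i'(1) show False by simp
    qed
    have X: "card ?X \<le> 1" if "b \<noteq> e"
    proof (rule card_le_oneI)
      fix l l' assume l: "l \<in> ?X" "l' \<in> ?X"
      then have "b' = e'" using xx by blast
      then have "s b b' \<noteq> s e e'" using s_eq that by blast
      then have "coprime (s b b' - s e e') T" using s_diff by (intro copT) auto
      then have "int l = int l'"
        using xx[OF l(1)] xx[OF l(2)] l j by (intro mod_linear_unique[of "s b b'" "int l" c T "s e e'" f "int l'"]) (auto simp: T_def)
      then show "l = l'" by simp
    qed simp
    have Y: "card ?Y \<le> 1" if "b' \<noteq> e'"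
    proof (rule card_le_oneI)
      fix l l' assume l: "l \<in> ?Y" "l' \<in> ?Y"
      then have "b = e" using yy by blast
      then have "s b b' \<noteq> s e e'" using s_eq' that by blast
      \<comment> \<open>The image line has the slope of the point line multiplied by
        \<open>a\<close>, which is a unit modulo \<open>T\<close> like every positive integer up to
        \<open>Q\<close>.\<close>
      then have "coprime (a * (s b b' - s e e')) T" using s_diff i(2)
        by (auto intro!: copT simp: coprime_mult_left_iff)
      then have "int l = int l'"
        using yy[OF l(1)] yy[OF l(2)] l j
        by (intro mod_linear_unique[of "a * s b b'" "int l" "(a + 1) * c" T "a * s e e'" "(a + 1) * f" "int l'"])
          (auto simp: T_def right_diff_distrib)
      then show "l = l'" by simp
    qed simp
    have XY0: "?X = {} \<and> ?Y = {}" if "b = e" "b' = e'"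
    proof -
      { fix l assume "(s b b' * int l + c) mod T = (s b b' * int l + f) mod T" "a = d"
        then have "(1 * c + s b b' * int l) mod T = (1 * f + s b b' * int l) mod T" by (simp add: add.commute)
        then have "c = f" by (rule mod_linear_eqD) (use i i' in auto)
        with ii(3) i(1) i'(1) that \<open>a = d\<close> have False by simp }
      moreover
      { fix l assume "(a * s b b' * int l + (a + 1) * c) mod T = (a * s b b' * int l + (a + 1) * f) mod T" "a = d"
        then have "((a + 1) * c + a * s b b' * int l) mod T = ((a + 1) * f + a * s b b' * int l) mod T" by (simp add: add.commute)
        \<comment> \<open>In the image line \<open>c\<close> carries the factor
          \<open>a + 1\<close>: once from the point and \<open>a\<close> times from the scaling.
          This factor is at most \<open>Q\<close>, hence a unit modulo \<open>T\<close>.\<close>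
        then have "c = f" by (rule mod_linear_eqD) (use i i' in \<open>auto intro: copT\<close>)
        with ii(3) i(1) i'(1) that \<open>a = d\<close> have False by simp }
      ultimately show ?thesis using xx yy that by blast
    qed
    show "card ?V + card ?X + card ?Y \<le> 1"
    proof (cases "a = d")
      case False
      then have XY: "?X = {}" "?Y = {}" using xx yy by blast+
      show ?thesis using V[OF False] unfolding XY by simp
    next
      case True
      consider "b = e" "b' = e'" | "b \<noteq> e" | "b = e" "b' \<noteq> e'" by blast
      then show ?thesis
      proof cases
        case 1
        then have XY: "?X = {}" "?Y = {}" using XY0 by blast+
        show ?thesis unfolding XY V0[OF True] by simp
      next
        case 2
        then have Y0: "?Y = {}" using yy by blast
        show ?thesis using X[OF 2] unfolding Y0 V0[OF True] by simp
      next
        case 3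
        then have X0: "?X = {}" using xx by blast
        show ?thesis using Y[OF 3(2)] unfolding X0 V0[OF True] by simp
      qed
    qed
  qed
  then show ?thesis by (simp add: cardA cardI)
qed

section \<open>Mertens' first theorem\<close>

lemma card_multiples:
  fixes u w d :: nat
  assumes "d > 0" "u \<le> w"
  shows "card {m \<in> {u<..w}. d dvd m} = w div d - u div d"
proof -
  have "{m \<in> {u<..w}. d dvd m} = (\<lambda>k. d * k) ` {u div d<..w div d}"
  proof (intro equalityI subsetI)
    fix m assume "m \<in> {m \<in> {u<..w}. d dvd m}"
    then obtain k where k: "m = d * k" "u < d * k" "d * k \<le> w" by auto
    then have "k \<in> {u div d<..w div d}"
      using assms(1) by (simp_all add: div_less_iff_less_mult less_eq_div_iff_mult_less_eq mult.commute)
    with k(1) show "m \<in> (\<lambda>k. d * k) ` {u div d<..w div d}" by blast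
  next
    fix m assume "m \<in> (\<lambda>k. d * k) ` {u div d<..w div d}"
    then obtain k where k: "m = d * k" "u div d < k" "k \<le> w div d" by (elim imageE) auto
    then have "u < d * k" "d * k \<le> w"
      using assms(1) by (simp_all add: div_less_iff_less_mult less_eq_div_iff_mult_less_eq mult.commute)
    with k show "m \<in> {m \<in> {u<..w}. d dvd m}" by auto
  qed
  moreover have "inj_on (\<lambda>k. d * k) {u div d<..w div d}"
    using assms(1) by (auto simp: inj_on_def)
  ultimately show ?thesis by (simp add: card_image)
qed

lemma prod_primes_dvd_iff:
  fixes D :: "nat set"
  assumes "finite D" "\<And>p. p \<in> D \<Longrightarrow> prime p"
  shows "\<Prod>D dvd a \<longleftrightarrow> (\<forall>p\<in>D. p dvd a)"
  using assms
proof (induction D rule: finite_induct)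
  case (insert p D)
  have "coprime p (\<Prod>D)"
    using insert.prems insert.hyps by (intro prod_coprime_right) (auto intro: primes_coprime)
  then have "p * \<Prod>D dvd a \<longleftrightarrow> p dvd a \<and> \<Prod>D dvd a"
    by (meson divides_mult dvd_mult_left dvd_mult_right)
  then show ?case using insert by simp
qed simp

text \<open>A range of exponents independent of \<open>m\<close> is wanted, so that the sums over
  \<open>m\<close> and \<open>k\<close> can be exchanged in \<open>legendre\<close>. It is long
  enough because \<open>k < 2 ^ k \<le> p ^ k \<le> n\<close>.\<close>

lemma multiplicity_eq_card:
  assumes "prime (p::nat)" "0 < m" "m \<le> n"
  shows "multiplicity p m = card {k \<in> {1..n}. p ^ k dvd m}"
proof -
  have "{k \<in> {1..n}. p ^ k dvd m} = {1..multiplicity p m}"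
  proof (intro equalityI subsetI)
    fix k assume "k \<in> {1..multiplicity p m}"
    then have k: "1 \<le> k" "p ^ k dvd m" by (auto intro: multiplicity_dvd')
    have "k < 2 ^ k" by simp
    also have "2 ^ k \<le> p ^ k" using assms(1) by (intro power_mono) (auto dest: prime_ge_2_nat)
    also have "p ^ k \<le> n" using dvd_imp_le[OF k(2) assms(2)] assms(3) by simp
    finally show "k \<in> {k \<in> {1..n}. p ^ k dvd m}" using k by simp
  next
    fix k assume "k \<in> {k \<in> {1..n}. p ^ k dvd m}"
    moreover have "\<not> is_unit p" using assms(1) by (auto)
    ultimately show "k \<in> {1..multiplicity p m}"
      using assms(2) by (auto intro: multiplicity_geI)
  qed
  then show ?thesis by simp
qed

lemma multiplicity_fact_eq_sum:
  assumes "prime (p::nat)"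
  shows "multiplicity p (fact n) = (\<Sum>m = 1..n. multiplicity p m)"
proof (induction n)
  case (Suc n)
  have "multiplicity p (fact (Suc n)) = multiplicity p (Suc n * fact n)" by simp
  also have "\<dots> = multiplicity p (Suc n) + multiplicity p (fact n)"
    using assms by (intro prime_elem_multiplicity_mult_distrib) auto
  finally show ?case using Suc.IH by simp
qed simp

lemma card_filter_eq_sum: "finite A \<Longrightarrow> card {x \<in> A. P x} = (\<Sum>x\<in>A. if P x then 1 else 0)"
  by (simp add: sum.inter_filter[symmetric])

lemma legendre:
  assumes "prime (p::nat)"
  shows "multiplicity p (fact n) = (\<Sum>k = 1..n. n div p ^ k)"
proof -
  have "multiplicity p (fact n) = (\<Sum>m = 1..n. card {k \<in> {1..n}. p ^ k dvd m})"
    unfolding multiplicity_fact_eq_sum[OF assms]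
    by (intro sum.cong refl multiplicity_eq_card assms) simp_all
  also have "\<dots> = (\<Sum>m = 1..n. \<Sum>k = 1..n. if p ^ k dvd m then 1 else 0)"
    by (intro sum.cong refl) (simp only: card_filter_eq_sum finite_atLeastAtMost)
  also have "\<dots> = (\<Sum>k = 1..n. \<Sum>m = 1..n. if p ^ k dvd m then 1 else 0)"
    by (rule sum.swap)
  also have "\<dots> = (\<Sum>k = 1..n. card {m \<in> {1..n}. p ^ k dvd m})"
    by (intro sum.cong refl) (simp only: card_filter_eq_sum finite_atLeastAtMost)
  also have "\<dots> = (\<Sum>k = 1..n. n div p ^ k)"
  proof (intro sum.cong refl)
    fix k
    have "{m \<in> {1..n}. p ^ k dvd m} = {m \<in> {0<..n}. p ^ k dvd m}" by auto
    then show "card {m \<in> {1..n}. p ^ k dvd m} = n div p ^ k"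
      using card_multiples[of "p ^ k" 0 n] assms by (simp add: prime_gt_0_nat)
  qed
  finally show ?thesis .
qed

text \<open>From Legendre's sum the lower bound keeps only \<open>k = 1\<close>; the upper bound
  drops the floors and compares with a geometric series.\<close>

lemma multiplicity_fact_bounds:
  assumes "prime (p::nat)" "p \<le> n"
  shows "real n / p - 1 \<le> multiplicity p (fact n)" "multiplicity p (fact n) \<le> real n / (real p - 1)"
proof -
  have p: "p \<ge> 2" using assms(1) by (rule prime_ge_2_nat)
  have "real n / p - 1 \<le> real (n div p)"
    using floor_divide_of_nat_eq[of n p, where ?'a = real] floor_correct[of "real n / real p"] by linarith
  also have "n div p ^ 1 \<le> (\<Sum>k = 1..n. n div p ^ k)"
    using p assms(2) by (intro member_le_sum) auto
  then have "n div p \<le> multiplicity p (fact n)"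
    unfolding legendre[OF assms(1)] by simp
  then have "real (n div p) \<le> multiplicity p (fact n)" by (rule of_nat_mono)
  finally show "real n / p - 1 \<le> multiplicity p (fact n)" .
  have "real (multiplicity p (fact n)) \<le> (\<Sum>k = 1..n. real n / p ^ k)"
    unfolding legendre[OF assms(1)] of_nat_sum
    by (intro sum_mono) (metis of_nat_power of_nat_div_le_of_nat)
  also have "\<dots> = real n * (\<Sum>k = 1..n. (1 / real p) ^ k)"
    by (simp add: sum_distrib_left power_one_over field_simps)
  also have "(\<Sum>k = 1..n. (1 / real p) ^ k) \<le> 1 / (real p - 1)"
  proof -
    have "(\<Sum>k = 1..n. (1 / real p) ^ k) = (1 / real p) * (\<Sum>k<n. (1 / real p) ^ k)"
      by (simp add: sum_distrib_left lessThan_atLeast0 sum.shift_bounds_Suc_ivl[symmetric] atLeastLessThanSuc_atLeastAtMost flip: power_Suc)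
    also have "(\<Sum>k<n. (1 / real p) ^ k) = (1 - (1 / real p) ^ n) / (1 - 1 / real p)"
      using p by (subst sum_gp_strict) auto
    also have "\<dots> \<le> 1 / (1 - 1 / real p)"
      using p by (intro divide_right_mono) auto
    finally show ?thesis using p by (simp add: field_simps)
  qed
  finally show "multiplicity p (fact n) \<le> real n / (real p - 1)"
    by (simp add: mult_left_mono)
qed

abbreviation primes_le :: "nat \<Rightarrow> nat set" where
  "primes_le n \<equiv> {p. prime p \<and> p \<le> n}"

lemma finite_primes_le [simp]: "finite (primes_le n)"
  by (rule finite_subset[of _ "{..n}"]) auto

lemma ln_prime_nonneg: "prime p \<Longrightarrow> 0 \<le> ln (real p)"
  using prime_ge_1_nat[of p] by simp

lemma ln_fact_eq_sum_primes:
  "ln (fact n) = (\<Sum>p\<in>primes_le n. real (multiplicity p (fact n)) * ln p)"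
proof -
  have pf: "prime_factors (fact n :: nat) = primes_le n"
    by (auto simp: prime_factors_dvd prime_dvd_fact_iff)
  have "real (fact n) = (\<Prod>p\<in>primes_le n. real p ^ multiplicity p (fact n))"
    using arg_cong[OF prime_factorization_nat[of "fact n"], of real] unfolding pf by simp
  then have "ln (real (fact n)) = (\<Sum>p\<in>primes_le n. ln (real p ^ multiplicity p (fact n)))"
    by (simp only:) (rule ln_prod, auto simp: prime_gt_0_nat)
  also have "\<dots> = (\<Sum>p\<in>primes_le n. real (multiplicity p (fact n)) * ln p)"
    by (intro sum.cong refl) (auto simp: ln_realpow prime_gt_0_nat)
  finally show ?thesis by simp
qed

lemma ln_fact_upper: "n > 0 \<Longrightarrow> ln (fact n :: real) \<le> real n * ln n"
proof -
  assume "n > 0"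
  have "ln (fact n :: real) \<le> ln (real n ^ n)"
    using \<open>n > 0\<close> fact_le_power[of n, where ?'a = real] by (subst ln_le_cancel_iff) auto
  then show ?thesis using \<open>n > 0\<close> by (simp add: ln_realpow)
qed

lemma ln_fact_lower: "n > 0 \<Longrightarrow> real n * ln n - n \<le> ln (fact n :: real)"
proof (induction n rule: nat_induct_non_zero)
  case (Suc n)
  have "ln (1 + 1 / real n) \<le> 1 / n"
    using Suc.hyps by (intro ln_add_one_self_le_self) auto
  moreover have "1 + 1 / real n = real (Suc n) / n" using Suc.hyps by (simp add: field_simps)
  ultimately have "real n * (ln (Suc n) - ln n) \<le> 1"
    using Suc.hyps by (simp add: ln_div field_simps)
  moreover have "ln (fact (Suc n) :: real) = ln (Suc n) + ln (fact n)"
    by (simp add: ln_mult_pos)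
  ultimately show ?case using Suc.IH by (simp add: algebra_simps)
qed simp

section \<open>Chebyshev's upper bound\<close>

text \<open>A prime in this range divides the factorial of \<open>2 * n\<close> but not that of
  \<open>n\<close>.\<close>

lemma prod_primes_dvd_central_binomial:
  "\<Prod>{p. prime p \<and> n < p \<and> p \<le> 2 * n} dvd (2 * n) choose n"
proof (subst prod_primes_dvd_iff)
  show "finite {p. prime p \<and> n < p \<and> p \<le> 2 * n}" by (rule finite_subset[of _ "{..2 * n}"]) auto
  show "\<forall>p\<in>{p. prime p \<and> n < p \<and> p \<le> 2 * n}. p dvd 2 * n choose n"
  proof
    fix p assume p: "p \<in> {p. prime p \<and> n < p \<and> p \<le> 2 * n}"
    have "fact n * fact n * (2 * n choose n) = (fact (2 * n) :: nat)"
      using binomial_fact_lemma[of n "2 * n"] by (simp add: mult_2)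
    moreover have "p dvd fact (2 * n)" "\<not> p dvd fact n"
      using p by (auto simp: prime_dvd_fact_iff)
    ultimately show "p dvd 2 * n choose n"
      using p by (metis (no_types, lifting) mem_Collect_eq prime_dvd_mult_iff)
  qed
qed auto

definition theta :: "nat \<Rightarrow> real" where
  "theta n = (\<Sum>p\<in>primes_le n. ln (real p))"

lemma theta_mono: "m \<le> n \<Longrightarrow> theta m \<le> theta n"
  unfolding theta_def by (intro sum_mono2) (auto simp: ln_prime_nonneg)

lemma theta_double: "theta (2 * n) \<le> theta n + 2 * real n * ln 2"
proof -
  let ?P = "{p. prime p \<and> n < p \<and> p \<le> 2 * n}"
  have fin: "finite ?P" by (rule finite_subset[of _ "{..2 * n}"]) auto
  have "primes_le (2 * n) = primes_le n \<union> ?P" by auto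
  then have "theta (2 * n) = theta n + (\<Sum>p\<in>?P. ln (real p))"
    unfolding theta_def using fin by (simp only:) (rule sum.union_disjoint, auto)
  also have "(\<Sum>p\<in>?P. ln (real p)) = ln (\<Prod>p\<in>?P. real p)"
    using fin by (intro ln_prod[symmetric]) auto
  also have "\<dots> \<le> ln (2 ^ (2 * n))"
  proof -
    have "\<Prod>?P \<le> 2 * n choose n"
      by (intro dvd_imp_le prod_primes_dvd_central_binomial) simp
    also have "(2 * n choose n) \<le> 2 ^ (2 * n)"
      by (rule binomial_le_pow2)
    finally have "real (\<Prod>?P) \<le> real (2 ^ (2 * n))" by (rule of_nat_mono)
    moreover have "(\<Prod>p\<in>?P. real p) > 0" by (intro prod_pos) (auto simp: prime_gt_0_nat)
    ultimately show ?thesis by (subst ln_le_cancel_iff) auto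
  qed
  finally show ?thesis by (simp add: ln_realpow)
qed

text \<open>Repeated halving would give the constant 2 if no rounding occurred; 4 pays for rounding
  up. With \<open>2 * m \<le> n + 1\<close> the step needs \<open>3 * (n + 1) \<le> 4 * n\<close>,
  which holds from \<open>n = 3\<close> on.\<close>

lemma theta_le: "theta n \<le> 4 * ln 2 * n"
proof (induction n rule: less_induct)
  case (less n)
  consider "n \<le> 1" | "n = 2" | "n \<ge> 3" by linarith
  then show ?case
  proof cases
    case 1
    then have e: "primes_le n = {}" by (auto dest: prime_ge_2_nat)
    have "theta n = 0" unfolding theta_def by (simp only: e sum.empty)
    then show ?thesis by simp
  next
    case 2
    have "theta (2 * 1) \<le> theta 1 + 2 * 1 * ln 2" using theta_double[of 1] by simp
    moreover have e: "primes_le 1 = {}" by (auto dest: prime_ge_2_nat)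
    have "theta 1 = 0" unfolding theta_def by (simp only: e sum.empty)
    ultimately have "theta n \<le> 2 * ln 2" using 2 by simp
    also have "\<dots> \<le> 4 * ln 2 * n" using 2 by simp
    finally show ?thesis .
  next
    case 3
    define m where "m = (n + 1) div 2"
    have m: "m < n" "n \<le> 2 * m" "2 * m \<le> n + 1" using 3 by (auto simp: m_def)
    have "theta n \<le> theta (2 * m)" by (rule theta_mono) (use m in auto)
    also have "\<dots> \<le> theta m + 2 * real m * ln 2" by (rule theta_double)
    also have "\<dots> \<le> 4 * ln 2 * m + 2 * real m * ln 2" using less.IH[OF m(1)] by linarith
    also have "\<dots> = (6 * real m) * ln 2" by simp
    also have "\<dots> \<le> (4 * real n) * ln 2"
      using m(3) 3 by (intro mult_right_mono) auto
    finally show ?thesis by (simp add: mult_ac)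
  qed
qed

section \<open>Mertens' estimate at integers\<close>

definition mertens_sum :: "nat \<Rightarrow> real" where
  "mertens_sum n = (\<Sum>p\<in>primes_le n. ln (real p) / real p)"

text \<open>Dropping the floor in \<open>n div p\<close> costs at most \<open>ln p\<close> for each
  prime, so \<open>theta n\<close> in total, and Chebyshev's bound makes this linear in
  \<open>n\<close>.\<close>

lemma mertens_sum_upper:
  assumes "n > 0"
  shows "mertens_sum n \<le> ln n + 4"
proof -
  have "real n * mertens_sum n - theta n = (\<Sum>p\<in>primes_le n. (real n / p - 1) * ln p)"
    by (simp add: mertens_sum_def theta_def sum_distrib_left sum_subtractf algebra_simps)
  also have "\<dots> \<le> (\<Sum>p\<in>primes_le n. real (multiplicity p (fact n)) * ln p)"
    by (intro sum_mono mult_right_mono multiplicity_fact_bounds) (auto simp: ln_prime_nonneg)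
  also have "\<dots> \<le> real n * ln n"
    using ln_fact_eq_sum_primes[of n] ln_fact_upper[OF assms] by simp
  finally have "real n * mertens_sum n \<le> real n * ln n + 4 * ln 2 * n"
    using theta_le[of n] by linarith
  also have "4 * ln 2 * real n \<le> 4 * real n"
    using ln_2_less_1 by (intro mult_right_mono) auto
  finally have "real n * mertens_sum n \<le> real n * (ln n + 4)" by (simp add: algebra_simps)
  then show ?thesis using assms by simp
qed

text \<open>The right-hand side telescopes. Its numerator over the denominator
  \<open>k * (k - 1)\<close> is \<open>ln k + 2 - k * (ln k - ln (k - 1))\<close>, and the added 2
  is just what absorbs the last product.\<close>

lemma ln_div_pronic_le:
  assumes "k \<ge> (2::nat)"
  shows "ln k / (real k * (real k - 1)) \<le> (ln (real k - 1) + 2) / (real k - 1) - (ln k + 2) / k"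
proof -
  have k: "real k - 1 > 0" "real k - 1 \<ge> 1" using assms by auto
  have "ln (1 + 1 / (real k - 1)) \<le> 1 / (real k - 1)"
    using k by (intro ln_add_one_self_le_self) auto
  also have "1 + 1 / (real k - 1) = k / (real k - 1)" using k by (simp add: field_simps)
  also have "ln (k / (real k - 1)) = ln k - ln (real k - 1)"
    using k assms by (subst ln_div) auto
  finally have "real k * (ln k - ln (real k - 1)) \<le> real k * (1 / (real k - 1))"
    by (rule mult_left_mono) simp
  also have "\<dots> \<le> 2" using k by (simp add: field_simps)
  finally have *: "real k * (ln k - ln (real k - 1)) \<le> 2" .
  have "(ln (real k - 1) + 2) / (real k - 1) - (ln k + 2) / k
      = (real k * (ln (real k - 1) + 2) - (real k - 1) * (ln k + 2)) / (real k * (real k - 1))"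
    using k by (simp add: field_simps)
  also have "\<dots> \<ge> ln k / (real k * (real k - 1))"
    using k * by (intro divide_right_mono) (auto simp: algebra_simps)
  finally show ?thesis .
qed

lemma sum_ln_div_pronic_le: "(\<Sum>k = 2..n. ln (real k) / (real k * (real k - 1))) \<le> 2"
proof -
  have "(\<Sum>k = 2..n. ln (real k) / (real k * (real k - 1))) \<le> 2 - (ln n + 2) / n" if "n \<ge> 1"
    using that
  proof (induction n rule: nat_induct_at_least)
    case (Suc n)
    have "ln (Suc n) / (real (Suc n) * (real (Suc n) - 1)) \<le> (ln n + 2) / n - (ln (Suc n) + 2) / Suc n"
      using ln_div_pronic_le[of "Suc n"] Suc.hyps by simp
    with Suc show ?case by (simp del: of_nat_Suc)
  qed simp
  moreover have "(ln n + 2) / n \<ge> 0" if "n \<ge> 1" using that by simp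
  ultimately show ?thesis by (cases "n \<ge> 1") (linarith, simp)
qed

text \<open>Of the loss 3, one unit comes from the lower bound for \<open>ln (fact n)\<close>. The
  other two bound the higher prime powers, which contribute \<open>ln p / (p * (p - 1))\<close> per
  prime; summing this over all integers instead of primes is affordable.\<close>

lemma mertens_sum_lower:
  assumes "n > 0"
  shows "ln n - 3 \<le> mertens_sum n"
proof -
  have split: "ln (real p) / (real p - 1) = ln p / p + ln p / (real p * (real p - 1))" if "prime p" for p
    using prime_gt_1_nat[OF that] by (simp add: field_simps)
  have "real n * ln n - n \<le> (\<Sum>p\<in>primes_le n. real (multiplicity p (fact n)) * ln p)"
    using ln_fact_eq_sum_primes[of n] ln_fact_lower[OF assms] by simp
  also have "\<dots> \<le> (\<Sum>p\<in>primes_le n. (real n / (real p - 1)) * ln p)"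
    by (intro sum_mono mult_right_mono multiplicity_fact_bounds) (auto simp: ln_prime_nonneg)
  also have "\<dots> = real n * (\<Sum>p\<in>primes_le n. ln p / (real p - 1))"
    by (simp add: sum_distrib_left)
  also have "(\<Sum>p\<in>primes_le n. ln p / (real p - 1)) =
      mertens_sum n + (\<Sum>p\<in>primes_le n. ln p / (real p * (real p - 1)))"
    unfolding mertens_sum_def sum.distrib[symmetric] by (intro sum.cong refl split) auto
  also have "(\<Sum>p\<in>primes_le n. ln p / (real p * (real p - 1))) \<le> (\<Sum>k = 2..n. ln k / (real k * (real k - 1)))"
    by (rule sum_mono2) (auto dest: prime_ge_2_nat)
  also have "\<dots> \<le> 2" by (rule sum_ln_div_pronic_le)
  finally have "real n * ln n - n \<le> real n * (mertens_sum n + 2)"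
    by (simp add: mult_left_mono)
  then have "real n * (ln n - 1) \<le> real n * (mertens_sum n + 2)" by (simp add: algebra_simps)
  then show ?thesis using assms by simp
qed

section \<open>Primes between real bounds\<close>

definition primes_between :: "real \<Rightarrow> real \<Rightarrow> nat set" where
  "primes_between y w = {p. prime p \<and> y < real p \<and> real p \<le> w}"

lemma finite_primes_between [simp]: "finite (primes_between y w)"
  by (rule finite_subset[of _ "primes_le (nat \<lfloor>w\<rfloor>)"]) (auto simp: primes_between_def le_nat_floor)

lemma ln_floor_bounds:
  assumes "x \<ge> 1"
  shows "nat \<lfloor>x\<rfloor> > 0" "ln x - 1 \<le> ln (nat \<lfloor>x\<rfloor>)" "ln (nat \<lfloor>x\<rfloor>) \<le> ln x"
proof -
  have n: "nat \<lfloor>x\<rfloor> \<ge> 1" using assms by (simp add: le_nat_floor)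
  then show "nat \<lfloor>x\<rfloor> > 0" by linarith
  have "real (nat \<lfloor>x\<rfloor>) \<le> x" "x < real (nat \<lfloor>x\<rfloor>) + 1" using assms by linarith+
  then have le: "real (nat \<lfloor>x\<rfloor>) \<le> x" "x \<le> 2 * real (nat \<lfloor>x\<rfloor>)" using n by linarith+
  then show "ln (nat \<lfloor>x\<rfloor>) \<le> ln x" using n assms by (intro ln_mono) linarith+
  have "ln x \<le> ln (2 * real (nat \<lfloor>x\<rfloor>))" using le n assms by (subst ln_le_cancel_iff) auto
  also have "\<dots> = ln 2 + ln (nat \<lfloor>x\<rfloor>)" using n assms by (subst ln_mult_pos) auto
  finally show "ln x - 1 \<le> ln (nat \<lfloor>x\<rfloor>)" using ln_2_less_1 by linarith
qed

text \<open>The constant is 4 + 3 from the two one-sided bounds at the endpoints, plus 1 for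
  replacing a real endpoint by its floor.\<close>

theorem mertens:
  assumes "1 \<le> y" "y \<le> w"
  shows "\<bar>(\<Sum>p\<in>primes_between y w. ln p / p) - (ln w - ln y)\<bar> \<le> 8"
proof -
  let ?m = "nat \<lfloor>y\<rfloor>" and ?n = "nat \<lfloor>w\<rfloor>"
  have "primes_le ?n = primes_le ?m \<union> primes_between y w"
  proof -
    have "p \<le> ?m \<longleftrightarrow> real p \<le> y" "p \<le> ?n \<longleftrightarrow> real p \<le> w" for p
      using assms by (simp_all add: le_nat_iff le_floor_iff)
    then show ?thesis using assms(2) unfolding primes_between_def by auto
  qed
  moreover have "primes_le ?m \<inter> primes_between y w = {}"
    using assms(1) by (auto simp: primes_between_def le_nat_iff le_floor_iff)
  ultimately have "mertens_sum ?n = mertens_sum ?m + (\<Sum>p\<in>primes_between y w. ln p / p)"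
    unfolding mertens_sum_def by (simp only:) (rule sum.union_disjoint, auto)
  moreover have w: "1 \<le> w" using assms by simp
  note y' = ln_floor_bounds[OF assms(1)] and w' = ln_floor_bounds[OF w]
  note mertens_sum_upper[OF w'(1)] mertens_sum_lower[OF w'(1)] mertens_sum_upper[OF y'(1)] mertens_sum_lower[OF y'(1)]
  ultimately show ?thesis using y'(2,3) w'(2,3) unfolding abs_le_iff by linarith
qed

lemma ex_prime_between:
  assumes "1 \<le> y" "ln w > ln y + 8" "w \<ge> y"
  shows "\<exists>p. prime p \<and> y < real p \<and> real p \<le> w"
proof (rule ccontr)
  assume "\<nexists>p. prime p \<and> y < real p \<and> real p \<le> w"
  then have "primes_between y w = {}" by (auto simp: primes_between_def)
  with mertens[of y w] assms show False by simp
qed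

text \<open>All primes in the range satisfy \<open>ln y \<le> ln p\<close>, so Mertens' theorem
  applies after multiplying by \<open>ln y\<close>. This gives \<open>a - 1\<close> where partial
  summation would give \<open>ln a\<close>, but needs no further tools.\<close>

lemma sum_inverse_primes_le:
  assumes "1 < y" "a \<ge> 1"
  shows "(\<Sum>p\<in>primes_between y (y powr a). 1 / p) \<le> a - 1 + 8 / ln y"
proof -
  have ly: "ln y > 0" using assms by simp
  have yw: "y \<le> y powr a" using assms powr_mono[of 1 a y] by simp
  have "ln y * (\<Sum>p\<in>primes_between y (y powr a). 1 / p) = (\<Sum>p\<in>primes_between y (y powr a). ln y / p)"
    by (simp add: sum_distrib_left)
  also have "\<dots> \<le> (\<Sum>p\<in>primes_between y (y powr a). ln p / p)"
    using assms by (intro sum_mono divide_right_mono) (auto simp: primes_between_def)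
  also have "\<dots> \<le> (ln (y powr a) - ln y) + 8"
    using mertens[of y "y powr a"] assms yw by linarith
  also have "\<dots> = ln y * (a - 1 + 8 / ln y)"
    using ly by (simp add: ln_powr algebra_simps)
  finally show ?thesis using ly by simp
qed

text \<open>An intermediate cut at exponent 3/2 recovers part of what the crude bound loses: 1/2 +
  1/2 in place of the 5/4 from a single application.\<close>

lemma sum_inverse_primes_le_two_step:
  assumes "1 < y"
  shows "(\<Sum>p\<in>primes_between y (y powr (9/4)). 1 / p) \<le> 1 + 16 / ln y"
proof -
  let ?u = "y powr (3/2)"
  have yu: "y \<le> ?u" "?u \<le> y powr (9/4)" using assms powr_mono[of 1 "3/2" y] by (auto intro: powr_mono)
  have u: "?u powr (3/2) = y powr (9/4)" using assms by (simp add: powr_powr)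
  have "primes_between y (y powr (9/4)) = primes_between y ?u \<union> primes_between ?u (y powr (9/4))"
    using yu by (auto simp: primes_between_def)
  moreover have "primes_between y ?u \<inter> primes_between ?u (y powr (9/4)) = {}"
    by (auto simp: primes_between_def)
  ultimately have "(\<Sum>p\<in>primes_between y (y powr (9/4)). 1 / real p) =
      (\<Sum>p\<in>primes_between y ?u. 1 / real p) + (\<Sum>p\<in>primes_between ?u (y powr (9/4)). 1 / real p)"
    by (simp add: sum.union_disjoint)
  also have "\<dots> \<le> (3/2 - 1 + 8 / ln y) + (3/2 - 1 + 8 / ln ?u)"
    using sum_inverse_primes_le[of y "3/2"] sum_inverse_primes_le[of ?u "3/2"] assms yu u by (intro add_mono) auto
  also have "8 / ln ?u \<le> 8 / ln y"
    using assms by (simp add: ln_powr field_simps)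
  finally show ?thesis by simp
qed

section \<open>The Brun--Hooley sieve\<close>

definition subsets_le :: "'a set \<Rightarrow> nat \<Rightarrow> 'a set set" where
  "subsets_le Q b = {D. D \<subseteq> Q \<and> card D \<le> b}"

text \<open>The part of degree at most \<open>b\<close> in the expansion of
  \<open>\<Prod>p\<in>Q. 1 - x p\<close>. General weights are kept because two choices occur:
  divisibility indicators for single integers, and \<open>1 / p\<close> for densities.\<close>

definition truncated_product :: "'a set \<Rightarrow> nat \<Rightarrow> ('a \<Rightarrow> real) \<Rightarrow> real" where
  "truncated_product Q b x = (\<Sum>D\<in>subsets_le Q b. (-1) ^ card D * (\<Prod>p\<in>D. x p))"

definition elem_sym :: "'a set \<Rightarrow> nat \<Rightarrow> ('a \<Rightarrow> real) \<Rightarrow> real" where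
  "elem_sym Q k x = (\<Sum>D | D \<subseteq> Q \<and> card D = k. \<Prod>p\<in>D. x p)"

lemma finite_subsets_le [simp]: "finite Q \<Longrightarrow> finite (subsets_le Q b)"
  unfolding subsets_le_def by (rule finite_subset[of _ "Pow Q"]) auto

lemma subsets_le_0: "finite Q \<Longrightarrow> subsets_le Q 0 = {{}}"
  by (auto simp: subsets_le_def dest: finite_subset)

lemma subsets_insert:
  assumes "finite Q" "p \<notin> Q"
  shows "{D. D \<subseteq> insert p Q \<and> P (card D)} =
    {D. D \<subseteq> Q \<and> P (card D)} \<union> insert p ` {D. D \<subseteq> Q \<and> P (Suc (card D))}" (is "?A = ?B \<union> ?C")
proof (intro equalityI subsetI)
  have card: "card (insert p D) = Suc (card D)" if "D \<subseteq> Q" for D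
    using that assms by (meson card_insert_disjoint finite_subset subset_iff)
  {
    fix D assume D: "D \<in> ?A"
    show "D \<in> ?B \<union> ?C"
    proof (cases "p \<in> D")
      case True
      then have "D = insert p (D - {p})" "D - {p} \<subseteq> Q" using D by auto
      then have "D - {p} \<in> {D. D \<subseteq> Q \<and> P (Suc (card D))}" using card[of "D - {p}"] D by simp
      then show ?thesis using \<open>D = insert p (D - {p})\<close> by blast
    next
      case False
      then show ?thesis using D by auto
    qed
  next
    fix D assume "D \<in> ?B \<union> ?C"
    then show "D \<in> ?A" using card by auto
  }
qed

lemma subsets_le_insert:
  assumes "finite Q" "p \<notin> Q"
  shows "subsets_le (insert p Q) (Suc b) = subsets_le Q (Suc b) \<union> insert p ` subsets_le Q b"
    and "{D. D \<subseteq> insert p Q \<and> card D = Suc b} = {D. D \<subseteq> Q \<and> card D = Suc b} \<union> insert p ` {D. D \<subseteq> Q \<and> card D = b}"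
  using subsets_insert[OF assms, of "\<lambda>c. c \<le> Suc b"] subsets_insert[OF assms, of "\<lambda>c. c = Suc b"]
  by (simp_all add: subsets_le_def)

lemma sum_insert_subsets:
  assumes "finite Q" "p \<notin> Q" "F \<subseteq> Pow Q" "G \<subseteq> Pow Q"
  shows "(\<Sum>D\<in>F \<union> insert p ` G. g D) = (\<Sum>D\<in>F. g D) + (\<Sum>D\<in>G. g (insert p D) :: real)"
proof -
  have fin: "finite F" "finite G" using assms by (auto intro: finite_subset)
  have "inj_on (insert p) G"
    by (rule inj_onI) (use assms(2,4) in \<open>metis Diff_insert_absorb PowD subsetD\<close>)
  moreover have "F \<inter> insert p ` G = {}" using assms by auto
  ultimately show ?thesis using fin by (simp add: sum.union_disjoint sum.reindex)
qed

lemma prod_insert_subset: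
  assumes "finite Q" "p \<notin> Q" "D \<subseteq> Q"
  shows "(\<Prod>q\<in>insert p D. x q :: real) = x p * (\<Prod>q\<in>D. x q)" "card (insert p D) = Suc (card D)"
  using assms by (meson card_insert_disjoint finite_subset prod.insert subset_iff)+

lemma truncated_product_insert:
  assumes "finite Q" "p \<notin> Q"
  shows "truncated_product (insert p Q) (Suc b) x = truncated_product Q (Suc b) x - x p * truncated_product Q b x"
proof -
  have "truncated_product (insert p Q) (Suc b) x = truncated_product Q (Suc b) x +
      (\<Sum>D\<in>subsets_le Q b. (-1) ^ card (insert p D) * (\<Prod>q\<in>insert p D. x q))"
    unfolding truncated_product_def subsets_le_insert(1)[OF assms]
    by (rule sum_insert_subsets[OF assms]) (auto simp: subsets_le_def)
  also have "(\<Sum>D\<in>subsets_le Q b. (-1) ^ card (insert p D) * (\<Prod>q\<in>insert p D. x q)) = - x p * truncated_product Q b x"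
    unfolding truncated_product_def sum_distrib_left
    by (intro sum.cong refl) (simp add: subsets_le_def prod_insert_subset[OF assms])
  finally show ?thesis by simp
qed

lemma elem_sym_insert:
  assumes "finite Q" "p \<notin> Q"
  shows "elem_sym (insert p Q) (Suc k) x = elem_sym Q (Suc k) x + x p * elem_sym Q k x"
proof -
  have "elem_sym (insert p Q) (Suc k) x = elem_sym Q (Suc k) x +
      (\<Sum>D | D \<subseteq> Q \<and> card D = k. \<Prod>q\<in>insert p D. x q)"
    unfolding elem_sym_def subsets_le_insert(2)[OF assms]
    by (rule sum_insert_subsets[OF assms]) auto
  also have "(\<Sum>D | D \<subseteq> Q \<and> card D = k. \<Prod>q\<in>insert p D. x q) = x p * elem_sym Q k x"
    unfolding elem_sym_def sum_distrib_left
    by (intro sum.cong refl) (simp add: prod_insert_subset[OF assms])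
  finally show ?thesis .
qed

text \<open>Adding \<open>p\<close> to \<open>Q\<close> subtracts \<open>x p\<close> times the
  truncation one degree lower. That truncation has the opposite parity, so its error has the
  opposite sign and the subtraction preserves the inequality; hence \<open>b\<close> varies in the
  induction.\<close>

lemma bonferroni:
  assumes "finite Q" "\<And>p. p \<in> Q \<Longrightarrow> 0 \<le> x p \<and> x p \<le> 1"
  shows "(even b \<longrightarrow> (\<Prod>p\<in>Q. 1 - x p) \<le> truncated_product Q b x) \<and>
         (odd b \<longrightarrow> truncated_product Q b x \<le> (\<Prod>p\<in>Q. 1 - x p))"
  using assms
proof (induction Q arbitrary: b rule: finite_induct)
  case empty
  have "subsets_le ({}::'a set) b = {{}}" by (auto simp: subsets_le_def)
  then show ?case by (simp add: truncated_product_def)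
next
  case (insert p Q)
  have x: "0 \<le> x p" "x p \<le> 1" and IH: "\<And>b. (even b \<longrightarrow> (\<Prod>p\<in>Q. 1 - x p) \<le> truncated_product Q b x) \<and>
         (odd b \<longrightarrow> truncated_product Q b x \<le> (\<Prod>p\<in>Q. 1 - x p))"
    using insert.prems insert.IH by auto
  have prod: "(\<Prod>p\<in>insert p Q. 1 - x p) = (\<Prod>p\<in>Q. 1 - x p) - x p * (\<Prod>p\<in>Q. 1 - x p)"
    using insert.hyps by (simp add: algebra_simps)
  show ?case
  proof (cases b)
    case 0
    have "(\<Prod>p\<in>insert p Q. 1 - x p) \<le> 1"
      using insert.prems by (intro prod_le_1) auto
    then show ?thesis
      using 0 insert.hyps by (simp add: truncated_product_def subsets_le_0)
  next
    case (Suc c)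
    have *: "truncated_product (insert p Q) b x = truncated_product Q b x - x p * truncated_product Q c x"
      unfolding Suc by (rule truncated_product_insert) (use insert.hyps in auto)
    show ?thesis
    proof (cases "even b")
      case True
      then have "x p * truncated_product Q c x \<le> x p * (\<Prod>p\<in>Q. 1 - x p)"
        using IH[of c] Suc x by (intro mult_left_mono) auto
      then show ?thesis using True IH[of b] unfolding * prod by auto
    next
      case False
      then have "x p * truncated_product Q c x \<ge> x p * (\<Prod>p\<in>Q. 1 - x p)"
        using IH[of c] Suc x by (intro mult_left_mono) auto
      then show ?thesis using False IH[of b] unfolding * prod by auto
    qed
  qed
qed

lemma truncated_product_Suc:
  assumes "finite Q"
  shows "truncated_product Q (Suc b) x = truncated_product Q b x + (-1) ^ Suc b * elem_sym Q (Suc b) x"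
proof -
  have "subsets_le Q (Suc b) = subsets_le Q b \<union> {D. D \<subseteq> Q \<and> card D = Suc b}"
    by (auto simp: subsets_le_def)
  moreover have "subsets_le Q b \<inter> {D. D \<subseteq> Q \<and> card D = Suc b} = {}"
    by (auto simp: subsets_le_def)
  moreover have "finite {D. D \<subseteq> Q \<and> card D = Suc b}"
    by (rule finite_subset[of _ "Pow Q"]) (use assms in auto)
  ultimately have "truncated_product Q (Suc b) x = truncated_product Q b x +
      (\<Sum>D | D \<subseteq> Q \<and> card D = Suc b. (-1) ^ card D * (\<Prod>p\<in>D. x p))"
    using assms by (simp add: truncated_product_def sum.union_disjoint)
  then show ?thesis by (simp add: elem_sym_def sum_distrib_left)
qed

text \<open>One further degree turns the upper bound into a lower bound, so the excess is at most
  the contribution of that degree.\<close>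

lemma truncated_product_le_add_elem_sym:
  assumes "finite Q" "\<And>p. p \<in> Q \<Longrightarrow> 0 \<le> x p \<and> x p \<le> 1" "even b"
  shows "truncated_product Q b x \<le> (\<Prod>p\<in>Q. 1 - x p) + elem_sym Q (Suc b) x"
  using bonferroni[of Q x "Suc b", OF assms(1,2)] truncated_product_Suc[where b = b and x = x, OF assms(1)] assms(3) by simp

lemma elem_sym_nonneg: "(\<And>p. p \<in> Q \<Longrightarrow> 0 \<le> x p) \<Longrightarrow> 0 \<le> elem_sym Q k x"
  unfolding elem_sym_def by (intro sum_nonneg prod_nonneg) auto

lemma power_add_ge:
  fixes s x :: real
  assumes "0 \<le> s" "0 \<le> x"
  shows "s ^ Suc k + Suc k * x * s ^ k \<le> (s + x) ^ Suc k"
proof (induction k)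
  case (Suc k)
  have "s ^ Suc (Suc k) + Suc (Suc k) * x * s ^ Suc k \<le> (s + x) * (s ^ Suc k + Suc k * x * s ^ k)"
    using assms by (simp add: algebra_simps)
  also have "\<dots> \<le> (s + x) * (s + x) ^ Suc k"
    by (intro mult_left_mono Suc.IH) (use assms in auto)
  finally show ?case by simp
qed simp

text \<open>In the \<open>k\<close>-th power of the sum each squarefree monomial of degree
  \<open>k\<close> occurs \<open>fact k\<close> times. The induction over \<open>Q\<close> needs
  only the first two binomial terms, supplied by \<open>power_add_ge\<close>.\<close>

lemma elem_sym_le:
  assumes "finite Q" "\<And>p. p \<in> Q \<Longrightarrow> 0 \<le> x p"
  shows "elem_sym Q k x \<le> (\<Sum>p\<in>Q. x p) ^ k / fact k"
  using assms
proof (induction Q arbitrary: k rule: finite_induct)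
  case empty
  have *: "{D. D \<subseteq> {} \<and> card D = k} = (if k = 0 then {{}} else {})" by auto
  show ?case unfolding elem_sym_def * by (cases k) auto
next
  case (insert p Q)
  let ?s = "\<Sum>p\<in>Q. x p"
  have s: "0 \<le> ?s" "0 \<le> x p" using insert.prems by (auto intro: sum_nonneg)
  have IH: "elem_sym Q k x \<le> ?s ^ k / fact k" for k
    using insert.IH insert.prems by blast
  show ?case
  proof (cases k)
    case 0
    have "{D. D \<subseteq> insert p Q \<and> card D = 0} = {{}}" using insert.hyps(1) by (auto dest: finite_subset)
    then show ?thesis by (simp add: 0 elem_sym_def)
  next
    case (Suc c)
    have "elem_sym (insert p Q) k x = elem_sym Q (Suc c) x + x p * elem_sym Q c x"
      unfolding Suc by (rule elem_sym_insert) (use insert.hyps in auto)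
    also have "\<dots> \<le> ?s ^ Suc c / fact (Suc c) + x p * (?s ^ c / fact c)"
      using IH[of "Suc c"] mult_left_mono[OF IH[of c] s(2)] by linarith
    also have "\<dots> = (?s ^ Suc c + Suc c * x p * ?s ^ c) / fact (Suc c)"
      by (simp add: field_simps del: of_nat_Suc)
    also have "\<dots> \<le> (?s + x p) ^ Suc c / fact (Suc c)"
      by (intro divide_right_mono power_add_ge s) auto
    finally show ?thesis using insert.hyps by (simp add: Suc add.commute)
  qed
qed

text \<open>A subset is encoded as a list of length exactly \<open>b\<close> over
  \<open>insert 0 Q\<close>, where 0 serves as padding.\<close>

lemma card_subsets_le_le:
  assumes "finite (Q :: nat set)" "0 \<notin> Q"
  shows "card (subsets_le Q b) \<le> (1 + card Q) ^ b"
proof -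
  let ?L = "{xs. set xs \<subseteq> insert 0 Q \<and> length xs = b}"
  have "subsets_le Q b \<subseteq> (\<lambda>xs. set xs \<inter> Q) ` ?L"
  proof
    fix D assume D: "D \<in> subsets_le Q b"
    then have "finite D" using assms(1) by (auto simp: subsets_le_def dest: finite_subset)
    then obtain ys where ys: "set ys = D" "length ys = card D"
      by (metis distinct_card finite_distinct_list)
    let ?xs = "ys @ replicate (b - card D) 0"
    have "?xs \<in> ?L" "set ?xs \<inter> Q = D"
      using D ys assms(2) by (auto simp: subsets_le_def)
    then show "D \<in> (\<lambda>xs. set xs \<inter> Q) ` ?L" by blast
  qed
  then have "card (subsets_le Q b) \<le> card ((\<lambda>xs. set xs \<inter> Q) ` ?L)"
    using assms(1) by (intro card_mono finite_imageI finite_lists_length_eq) auto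
  also have "\<dots> \<le> card ?L"
    using assms(1) by (intro card_image_le finite_lists_length_eq) auto
  also have "\<dots> = (1 + card Q) ^ b"
    using assms by (simp add: card_lists_length_eq)
  finally show ?thesis .
qed

text \<open>Quantifying over all \<open>m\<close> prime to \<open>Q\<close> makes this property multiplicative: the divisors
  occurring in a further factor are absorbed into \<open>m\<close>.\<close>

definition has_mean :: "nat set \<Rightarrow> (nat \<Rightarrow> real) \<Rightarrow> real \<Rightarrow> real \<Rightarrow> bool" where
  "has_mean Q f M E \<longleftrightarrow> (\<forall>m u w. m > 0 \<and> (\<forall>p\<in>Q. \<not> p dvd m) \<and> u \<le> w \<longrightarrow>
     \<bar>(\<Sum>a | a \<in> {u<..w} \<and> m dvd a. f a) - M * (real w - real u) / m\<bar> \<le> E)"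

definition divisor_sum :: "nat set set \<Rightarrow> (nat set \<Rightarrow> real) \<Rightarrow> nat \<Rightarrow> real" where
  "divisor_sum F c a = (\<Sum>D\<in>F. c D * of_bool (\<Prod>D dvd a))"

lemma has_mean_one: "has_mean {} (\<lambda>_. 1) 1 1"
  unfolding has_mean_def
proof (intro allI impI)
  fix m u w :: nat
  assume "m > 0 \<and> (\<forall>p\<in>{}. \<not> p dvd m) \<and> u \<le> w"
  then have m: "m > 0" "u \<le> w" by auto
  have "{a. a \<in> {u<..w} \<and> m dvd a} = {a \<in> {u<..w}. m dvd a}" by auto
  then have "(\<Sum>a | a \<in> {u<..w} \<and> m dvd a. 1) = real (w div m - u div m)"
    using card_multiples[OF m] by simp
  also have "\<dots> = real (w div m) - real (u div m)"
    using m by (simp add: of_nat_diff div_le_mono)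
  finally show "\<bar>(\<Sum>a | a \<in> {u<..w} \<and> m dvd a. 1) - 1 * (real w - real u) / real m\<bar> \<le> 1"
    using floor_divide_of_nat_eq[of w m, where ?'a = real] floor_correct[of "real w / real m"]
      floor_divide_of_nat_eq[of u m, where ?'a = real] floor_correct[of "real u / real m"]
    unfolding abs_le_iff diff_divide_distrib mult_1 by linarith
qed

lemma has_mean_mult:
  assumes f: "has_mean Q f M E" and primes: "\<And>p. p \<in> Q \<union> R \<Longrightarrow> prime p" and "finite R" "Q \<inter> R = {}" "finite F"
    and F: "\<And>D. D \<in> F \<Longrightarrow> D \<subseteq> R" and c: "\<And>D. D \<in> F \<Longrightarrow> \<bar>c D\<bar> \<le> 1"
  shows "has_mean (Q \<union> R) (\<lambda>a. divisor_sum F c a * f a) ((\<Sum>D\<in>F. c D / real (\<Prod>D)) * M) (real (card F) * E)"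
  unfolding has_mean_def
proof (intro allI impI)
  fix m u w :: nat
  assume "m > 0 \<and> (\<forall>p\<in>Q \<union> R. \<not> p dvd m) \<and> u \<le> w"
  then have m: "m > 0" "\<And>p. p \<in> Q \<union> R \<Longrightarrow> \<not> p dvd m" "u \<le> w" by auto
  have D: "finite D" "\<And>p. p \<in> D \<Longrightarrow> prime p" "\<Prod>D > 0" if "D \<in> F" for D
  proof -
    show "finite D" using F[OF that] \<open>finite R\<close> by (rule finite_subset)
    show "prime p" if "p \<in> D" for p using F[OF \<open>D \<in> F\<close>] that primes by blast
    then show "\<Prod>D > 0" by (intro prod_pos) (auto simp: prime_gt_0_nat)
  qed
  have cop: "m dvd a \<and> \<Prod>D dvd a \<longleftrightarrow> m * \<Prod>D dvd a" if "D \<in> F" for D a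
  proof -
    have "coprime m (\<Prod>D)"
    proof (intro prod_coprime_right)
      fix p assume "p \<in> D"
      then show "coprime m p" using F[OF that] m(2)[of p] primes[of p]
        by (metis UnCI coprime_commute prime_imp_coprime subsetD)
    qed
    then show ?thesis by (meson divides_mult dvd_mult_left dvd_mult_right)
  qed
  define T where "T D = (\<Sum>a | a \<in> {u<..w} \<and> m * \<Prod>D dvd a. f a)" for D
  have T: "\<bar>T D - M * (real w - real u) / (real m * real (\<Prod>D))\<bar> \<le> E" if "D \<in> F" for D
  proof -
    \<comment> \<open>The enlarged modulus remains admissible for \<open>Q\<close>: its additional
      prime factors lie in \<open>R\<close>, which is disjoint from \<open>Q\<close>.\<close>
    have "\<not> p dvd m * \<Prod>D" if "p \<in> Q" for p
    proof
      assume "p dvd m * \<Prod>D"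
      moreover have "prime p" using primes that by blast
      ultimately have "p dvd \<Prod>D" using m(2) that by (metis UnCI prime_dvd_mult_iff)
      then obtain r where "r \<in> D" "p dvd r"
        using \<open>prime p\<close> D(1)[OF \<open>D \<in> F\<close>] by (auto simp: prime_dvd_prod_iff)
      then have "p = r" using \<open>prime p\<close> D(2)[OF \<open>D \<in> F\<close>] by (simp add: primes_dvd_imp_eq)
      then show False using \<open>r \<in> D\<close> F[OF \<open>D \<in> F\<close>] that \<open>Q \<inter> R = {}\<close> by blast
    qed
    then have *: "m * \<Prod>D > 0 \<and> (\<forall>p\<in>Q. \<not> p dvd m * \<Prod>D) \<and> u \<le> w"
      using m(1,3) D(3)[OF that] by simp
    show ?thesis
      using f[unfolded has_mean_def, rule_format, OF *] unfolding T_def of_nat_mult .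
  qed
  have "(\<Sum>a | a \<in> {u<..w} \<and> m dvd a. divisor_sum F c a * f a)
      = (\<Sum>a | a \<in> {u<..w} \<and> m dvd a. \<Sum>D\<in>F. c D * (of_bool (\<Prod>D dvd a) * f a))"
    by (simp only: divisor_sum_def sum_distrib_right mult.assoc)
  also have "\<dots> = (\<Sum>D\<in>F. \<Sum>a | a \<in> {u<..w} \<and> m dvd a. c D * (of_bool (\<Prod>D dvd a) * f a))"
    by (rule sum.swap)
  also have "\<dots> = (\<Sum>D\<in>F. c D * T D)"
  proof (intro sum.cong refl)
    fix D assume "D \<in> F"
    have "(\<Sum>a | a \<in> {u<..w} \<and> m dvd a. of_bool (\<Prod>D dvd a) * f a) = T D"
      unfolding T_def
      by (intro sum.mono_neutral_cong_right) (auto simp: cop[OF \<open>D \<in> F\<close>, symmetric])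
    then show "(\<Sum>a | a \<in> {u<..w} \<and> m dvd a. c D * (of_bool (\<Prod>D dvd a) * f a)) = c D * T D"
      by (simp only: sum_distrib_left[symmetric])
  qed
  finally have eq: "(\<Sum>a | a \<in> {u<..w} \<and> m dvd a. divisor_sum F c a * f a) = (\<Sum>D\<in>F. c D * T D)" .
  have "(\<Sum>D\<in>F. c D / real (\<Prod>D)) * M * (real w - real u) / m =
      (\<Sum>D\<in>F. c D * (M * (real w - real u) / (real m * real (\<Prod>D))))"
  proof -
    have "x / P * M * r / k = x * (M * r / (k * P))" for x P r k :: real
      by (simp add: divide_inverse)
    then show ?thesis by (simp only: sum_distrib_right sum_divide_distrib)
  qed
  then have "(\<Sum>D\<in>F. c D * T D) - (\<Sum>D\<in>F. c D / real (\<Prod>D)) * M * (real w - real u) / m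
      = (\<Sum>D\<in>F. c D * (T D - M * (real w - real u) / (real m * real (\<Prod>D))))"
    by (simp only: right_diff_distrib sum_subtractf)
  also have "\<bar>\<dots>\<bar> \<le> (\<Sum>D\<in>F. \<bar>c D * (T D - M * (real w - real u) / (real m * real (\<Prod>D)))\<bar>)"
    by (rule sum_abs)
  also have "\<dots> \<le> (\<Sum>D\<in>F. 1 * E)"
    unfolding abs_mult by (intro sum_mono mult_mono c T) auto
  finally show "\<bar>(\<Sum>a | a \<in> {u<..w} \<and> m dvd a. divisor_sum F c a * f a) -
      (\<Sum>D\<in>F. c D / real (\<Prod>D)) * M * (real w - real u) / m\<bar> \<le> real (card F) * E"
    unfolding eq by simp
qed

text \<open>Families and coefficients are arbitrary so that one statement averages both the product
  of all truncations and the products in which one truncation is replaced by an elementary symmetric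
  sum.\<close>

lemma has_mean_prod:
  fixes R :: "nat \<Rightarrow> nat set"
  assumes "\<And>j p. j < k \<Longrightarrow> p \<in> R j \<Longrightarrow> prime p" "\<And>j. j < k \<Longrightarrow> finite (R j)"
    and "\<And>i j. i < j \<Longrightarrow> j < k \<Longrightarrow> R i \<inter> R j = {}"
    and "\<And>j. j < k \<Longrightarrow> finite (F j)" "\<And>j D. j < k \<Longrightarrow> D \<in> F j \<Longrightarrow> D \<subseteq> R j"
    and "\<And>j D. j < k \<Longrightarrow> D \<in> F j \<Longrightarrow> \<bar>c j D\<bar> \<le> 1"
  shows "has_mean (\<Union>j<k. R j) (\<lambda>a. \<Prod>j<k. divisor_sum (F j) (c j) a)
    (\<Prod>j<k. \<Sum>D\<in>F j. c j D / real (\<Prod>D)) (\<Prod>j<k. real (card (F j)))"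
  using assms
proof (induction k)
  case 0
  then show ?case using has_mean_one by simp
next
  case (Suc k)
  have IH: "has_mean (\<Union>j<k. R j) (\<lambda>a. \<Prod>j<k. divisor_sum (F j) (c j) a)
    (\<Prod>j<k. \<Sum>D\<in>F j. c j D / real (\<Prod>D)) (\<Prod>j<k. real (card (F j)))"
    by (rule Suc.IH) (use Suc.prems in \<open>auto simp: less_Suc_eq\<close>)
  have "has_mean ((\<Union>j<k. R j) \<union> R k) (\<lambda>a. divisor_sum (F k) (c k) a * (\<Prod>j<k. divisor_sum (F j) (c j) a))
    ((\<Sum>D\<in>F k. c k D / real (\<Prod>D)) * (\<Prod>j<k. \<Sum>D\<in>F j. c j D / real (\<Prod>D))) (real (card (F k)) * (\<Prod>j<k. real (card (F j))))"
  proof (rule has_mean_mult[OF IH])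
    show "(\<Union>j<k. R j) \<inter> R k = {}" using Suc.prems(3) by fastforce
  qed (use Suc.prems in \<open>auto simp: less_Suc_eq\<close>)
  then show ?case by (simp add: lessThan_Suc Un_commute mult.commute)
qed

section \<open>Hooley's inequality and the lower bound sieve\<close>

text \<open>Lower bounds for single factors could be negative and must not be multiplied. Only the
  upper bounds \<open>y\<close> are multiplied here, and each correction replaces a single factor by
  its error \<open>e\<close>; all remaining factors are nonnegative, so the induction
  closes.\<close>

lemma prod_ge_diff_sum:
  fixes x y e :: "nat \<Rightarrow> real"
  assumes "\<And>j. j < k \<Longrightarrow> 0 \<le> x j" "\<And>j. j < k \<Longrightarrow> x j \<le> y j" "\<And>j. j < k \<Longrightarrow> y j \<le> x j + e j"
  shows "(\<Prod>j<k. y j) - (\<Sum>l<k. \<Prod>j<k. if j = l then e j else y j) \<le> (\<Prod>j<k. x j)"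
  using assms
proof (induction k)
  case (Suc k)
  let ?Y = "\<Prod>j<k. y j" and ?X = "\<Prod>j<k. x j" and ?S = "\<Sum>l<k. \<Prod>j<k. if j = l then e j else y j"
  have IH: "?Y - ?S \<le> ?X" by (rule Suc.IH) (use Suc.prems in auto)
  have nn: "0 \<le> y j" "0 \<le> e j" if "j < Suc k" for j
    using Suc.prems(1)[OF that] Suc.prems(2)[OF that] Suc.prems(3)[OF that] by linarith+
  have Y: "0 \<le> ?Y" using nn(1) by (intro prod_nonneg) auto
  have S: "0 \<le> ?S" using nn by (intro sum_nonneg prod_nonneg) auto
  have "(\<Prod>j<Suc k. if j = k then e j else y j) = ?Y * e k" by simp
  moreover have "(\<Sum>l<k. \<Prod>j<Suc k. if j = l then e j else y j) = ?S * y k"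
    unfolding sum_distrib_right by (intro sum.cong refl) auto
  ultimately have eq: "(\<Sum>l<Suc k. \<Prod>j<Suc k. if j = l then e j else y j) = ?S * y k + ?Y * e k"
    by simp
  have "?Y * y k - (?S * y k + ?Y * e k) \<le> ?X * x k"
  proof -
    have "?Y * y k \<le> ?Y * x k + ?Y * e k"
      using Suc.prems(3)[of k] Y by (simp add: mult_left_mono flip: distrib_left)
    moreover have "?Y * x k \<le> (?X + ?S) * x k"
      using IH Suc.prems(1)[of k] by (intro mult_right_mono) auto
    moreover have "?S * x k \<le> ?S * y k"
      using S Suc.prems(2)[of k] by (intro mult_left_mono) auto
    ultimately show ?thesis by (simp add: algebra_simps)
  qed
  then show ?case unfolding eq by simp
qed simp

lemma prod_of_bool_dvd:
  assumes "finite D" "\<And>p. p \<in> D \<Longrightarrow> prime (p::nat)"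
  shows "(\<Prod>p\<in>D. of_bool (p dvd a) :: real) = of_bool (\<Prod>D dvd a)"
proof -
  have "(\<Prod>p\<in>D. of_bool (p dvd a) :: real) = of_bool (\<forall>p\<in>D. p dvd a)"
    using assms(1) by (induction D rule: finite_induct) auto
  then show ?thesis by (simp add: prod_primes_dvd_iff[OF assms])
qed

lemma truncated_product_eq_divisor_sum:
  assumes "finite Q" "\<And>p. p \<in> Q \<Longrightarrow> prime p"
  shows "truncated_product Q b (\<lambda>p. of_bool (p dvd a)) = divisor_sum (subsets_le Q b) (\<lambda>D. (-1) ^ card D) a"
  unfolding truncated_product_def divisor_sum_def
proof (intro sum.cong refl)
  fix D assume "D \<in> subsets_le Q b"
  then have "finite D" "\<And>p. p \<in> D \<Longrightarrow> prime p"
    using assms by (auto simp: subsets_le_def dest: finite_subset)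
  then show "(-1) ^ card D * (\<Prod>p\<in>D. of_bool (p dvd a)) = (-1) ^ card D * (of_bool (\<Prod>D dvd a) :: real)"
    by (simp only: prod_of_bool_dvd)
qed

lemma elem_sym_eq_divisor_sum:
  assumes "finite Q" "\<And>p. p \<in> Q \<Longrightarrow> prime p"
  shows "elem_sym Q k (\<lambda>p. of_bool (p dvd a)) = divisor_sum {D. D \<subseteq> Q \<and> card D = k} (\<lambda>_. 1) a"
  unfolding elem_sym_def divisor_sum_def
proof (intro sum.cong refl)
  fix D assume "D \<in> {D. D \<subseteq> Q \<and> card D = k}"
  then have "finite D" "\<And>p. p \<in> D \<Longrightarrow> prime p"
    using assms by (auto dest: finite_subset)
  then show "(\<Prod>p\<in>D. of_bool (p dvd a)) = 1 * (of_bool (\<Prod>D dvd a) :: real)"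
    by (simp only: prod_of_bool_dvd mult_1)
qed

lemma prod_scale_one:
  fixes y :: "nat \<Rightarrow> real"
  assumes "l < k"
  shows "(\<Prod>j<k. if j = l then c * y j else y j) = c * (\<Prod>j<k. y j)"
proof -
  have "(\<Prod>j<k. if j = l then c * y j else y j) = (\<Prod>j<k. (if j = l then c else 1) * y j)"
    by (intro prod.cong refl) auto
  then show ?thesis using assms by (simp add: prod.distrib prod.delta)
qed

text \<open>The inequality \<open>prod_ge_diff_sum\<close> is summed over the interval, with the
  indicator of having no prime factor in \<open>Q j\<close>, its truncation, and the first omitted
  elementary symmetric sum. Relative to the main term the \<open>l\<close>-th correction has size
  \<open>e l / U l\<close>, at most \<open>e l / V l\<close>, whence the hypothesis on
  \<open>\<delta>\<close>. In the remainder a power bounds the number of divisors from one range;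
  the extra factor \<open>1 + real (card (Q l))\<close> belongs to the one additional prime in the
  \<open>l\<close>-th correction.\<close>

theorem brun_hooley:
  fixes Q :: "nat \<Rightarrow> nat set" and b :: "nat \<Rightarrow> nat" and u w :: nat
  assumes primes: "\<And>j p. j < k \<Longrightarrow> p \<in> Q j \<Longrightarrow> prime p" and fin: "\<And>j. j < k \<Longrightarrow> finite (Q j)"
    and disj: "\<And>i j. i < j \<Longrightarrow> j < k \<Longrightarrow> Q i \<inter> Q j = {}" and even: "\<And>j. j < k \<Longrightarrow> even (b j)"
    and E: "(\<Sum>j<k. elem_sym (Q j) (Suc (b j)) (\<lambda>p. 1 / p) / (\<Prod>p\<in>Q j. 1 - 1 / real p)) \<le> \<delta>"
    and "\<delta> \<le> 1" "u \<le> w"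
  shows "(real w - real u) * (1 - \<delta>) * (\<Prod>j<k. \<Prod>p\<in>Q j. 1 - 1 / real p)
      - (1 + (\<Sum>l<k. 1 + real (card (Q l)))) * (\<Prod>j<k. (1 + real (card (Q j))) ^ b j)
    \<le> card {a \<in> {u<..w}. \<forall>j<k. \<forall>p\<in>Q j. \<not> p dvd a}"
proof -
  define V where "V j = (\<Prod>p\<in>Q j. 1 - 1 / real p)" for j
  define U where "U j = truncated_product (Q j) (b j) (\<lambda>p. 1 / real p)" for j
  define e where "e j = elem_sym (Q j) (Suc (b j)) (\<lambda>p. 1 / real p)" for j
  define N where "N j = (1 + real (card (Q j))) ^ b j" for j
  let ?X = "real w - real u"
  let ?F = "\<lambda>j. subsets_le (Q j) (b j)" and ?G = "\<lambda>j. {D. D \<subseteq> Q j \<and> card D = Suc (b j)}"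
  define xa where "xa a j = (\<Prod>p\<in>Q j. 1 - of_bool (p dvd a) :: real)" for a j
  define ya where "ya a j = divisor_sum (?F j) (\<lambda>D. (-1) ^ card D) a" for a j
  define ea where "ea a j = divisor_sum (?G j) (\<lambda>_. 1) a" for a j
  have inv: "0 \<le> 1 / real p \<and> 1 / real p < 1" if "j < k" "p \<in> Q j" for j p
    using prime_gt_1_nat[OF primes[OF that]] by simp
  have V: "0 < V j" if "j < k" for j
    unfolding V_def using inv[OF that] by (intro prod_pos) auto
  have VU: "V j \<le> U j" if "j < k" for j
    using bonferroni[OF fin[OF that], of "\<lambda>p. 1 / real p" "b j"] inv[OF that] even[OF that]
    unfolding U_def V_def by (force dest: less_imp_le)
  have U: "0 < U j" if "j < k" for j using V[OF that] VU[OF that] by simp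
  have e: "0 \<le> e j" if "j < k" for j
    unfolding e_def by (intro elem_sym_nonneg) auto
  have finG: "finite (?G j)" if "j < k" for j
    by (rule finite_subset[of _ "Pow (Q j)"]) (use fin[OF that] in auto)
  have inv_prod: "(\<Prod>p\<in>D. 1 / real p) = 1 / real (\<Prod>D)" for D :: "nat set"
    by (simp add: prod_dividef)
  have U_eq: "U j = (\<Sum>D\<in>?F j. (-1) ^ card D / real (\<Prod>D))" for j
    unfolding U_def truncated_product_def inv_prod by simp
  have e_eq: "e j = (\<Sum>D\<in>?G j. 1 / real (\<Prod>D))" for j
    unfolding e_def elem_sym_def inv_prod by simp
  have "0 \<notin> Q j" if "j < k" for j using primes[OF that] not_prime_0 by blast
  then have cardF: "real (card (subsets_le (Q j) c)) \<le> (1 + real (card (Q j))) ^ c" if "j < k" for j c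
    using of_nat_mono[OF card_subsets_le_le[OF fin[OF that], of c], where ?'a = real] that by simp
  have cardG: "real (card (?G j)) \<le> (1 + real (card (Q j))) * N j" if "j < k" for j
  proof -
    have "card (?G j) \<le> card (subsets_le (Q j) (Suc (b j)))"
      using fin[OF that] by (intro card_mono) (auto simp: subsets_le_def)
    then show ?thesis using cardF[OF that, of "Suc (b j)"] by (simp add: N_def)
  qed
  have N: "0 \<le> N j" for j by (simp add: N_def)

  have mean: "\<bar>(\<Sum>a\<in>{u<..w}. f a) - M * ?X\<bar> \<le> C" if "has_mean R f M C" "\<And>p. p \<in> R \<Longrightarrow> prime p" for R f M C
  proof -
    have "\<not> p dvd 1" if "p \<in> R" for p using \<open>\<And>p. p \<in> R \<Longrightarrow> prime p\<close>[OF that] by auto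
    then have *: "1 > (0::nat) \<and> (\<forall>p\<in>R. \<not> p dvd 1) \<and> u \<le> w" using \<open>u \<le> w\<close> by simp
    have "{a. a \<in> {u<..w} \<and> 1 dvd a} = {u<..w}" by auto
    then show ?thesis using that(1)[unfolded has_mean_def, rule_format, OF *] by (simp only: of_nat_1 div_by_1)
  qed
  have primesU: "prime p" if "p \<in> (\<Union>j<k. Q j)" for p using that primes by blast

  have "has_mean (\<Union>j<k. Q j) (\<lambda>a. \<Prod>j<k. ya a j) (\<Prod>j<k. U j) (\<Prod>j<k. real (card (?F j)))"
    unfolding ya_def U_eq
    by (rule has_mean_prod) (use primes fin disj in \<open>auto simp: subsets_le_def power_abs\<close>)
  from mean[OF this primesU]
  have "(\<Prod>j<k. U j) * ?X - (\<Prod>j<k. real (card (?F j))) \<le> (\<Sum>a\<in>{u<..w}. \<Prod>j<k. ya a j)"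
    by linarith
  moreover have "(\<Prod>j<k. real (card (?F j))) \<le> (\<Prod>j<k. N j)"
    unfolding N_def by (intro prod_mono) (use cardF in auto)
  ultimately have main: "(\<Prod>j<k. U j) * ?X - (\<Prod>j<k. N j) \<le> (\<Sum>a\<in>{u<..w}. \<Prod>j<k. ya a j)"
    by linarith

  have err: "(\<Sum>a\<in>{u<..w}. \<Prod>j<k. if j = l then ea a j else ya a j)
      \<le> (e l / V l) * (\<Prod>j<k. U j) * ?X + (1 + real (card (Q l))) * (\<Prod>j<k. N j)" if l: "l < k" for l
  proof -
    let ?H = "\<lambda>j. if j = l then ?G j else ?F j"
    let ?c = "\<lambda>j D. if j = l then 1 else (-1 :: real) ^ card D"
    have "has_mean (\<Union>j<k. Q j) (\<lambda>a. \<Prod>j<k. divisor_sum (?H j) (?c j) a)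
      (\<Prod>j<k. \<Sum>D\<in>?H j. ?c j D / real (\<Prod>D)) (\<Prod>j<k. real (card (?H j)))"
      by (rule has_mean_prod) (use primes fin finG disj in \<open>auto simp: subsets_le_def power_abs split: if_splits\<close>)
    moreover have "divisor_sum (?H j) (?c j) a = (if j = l then ea a j else ya a j)" for j a
      by (simp add: ea_def ya_def)
    moreover have "(\<Sum>D\<in>?H j. ?c j D / real (\<Prod>D)) = (if j = l then e j else U j)" for j
      by (simp add: e_eq U_eq)
    ultimately have "has_mean (\<Union>j<k. Q j) (\<lambda>a. \<Prod>j<k. if j = l then ea a j else ya a j)
      (\<Prod>j<k. if j = l then e j else U j) (\<Prod>j<k. real (card (?H j)))" by simp
    from mean[OF this primesU]
    have "(\<Sum>a\<in>{u<..w}. \<Prod>j<k. if j = l then ea a j else ya a j)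
      \<le> (\<Prod>j<k. if j = l then e j else U j) * ?X + (\<Prod>j<k. real (card (?H j)))"
      by linarith
    also have "(\<Prod>j<k. if j = l then e j else U j) = (\<Prod>j<k. if j = l then (e l / U l) * U j else U j)"
      using U[OF l] by (intro prod.cong refl) auto
    also have "\<dots> = (e l / U l) * (\<Prod>j<k. U j)"
      by (rule prod_scale_one[OF l])
    also have "(e l / U l) * (\<Prod>j<k. U j) \<le> (e l / V l) * (\<Prod>j<k. U j)"
      using e[OF l] VU[OF l] V[OF l] U
      by (intro mult_right_mono divide_left_mono prod_nonneg) (auto intro: less_imp_le mult_pos_pos)
    also have "(\<Prod>j<k. real (card (?H j))) \<le> (\<Prod>j<k. if j = l then (1 + real (card (Q l))) * N j else N j)"
      by (intro prod_mono) (use cardF cardG in \<open>auto simp: N_def\<close>)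
    also have "\<dots> = (1 + real (card (Q l))) * (\<Prod>j<k. N j)"
      by (rule prod_scale_one[OF l])
    finally show ?thesis using \<open>u \<le> w\<close> by (simp add: mult_right_mono)
  qed

  have pointwise: "(\<Prod>j<k. ya a j) - (\<Sum>l<k. \<Prod>j<k. if j = l then ea a j else ya a j) \<le> (\<Prod>j<k. xa a j)" for a
  proof (rule prod_ge_diff_sum)
    fix j assume j: "j < k"
    have ya: "ya a j = truncated_product (Q j) (b j) (\<lambda>p. of_bool (p dvd a))"
      unfolding ya_def using truncated_product_eq_divisor_sum[OF fin[OF j] primes[OF j]] by simp
    have ea: "ea a j = elem_sym (Q j) (Suc (b j)) (\<lambda>p. of_bool (p dvd a))"
      unfolding ea_def using elem_sym_eq_divisor_sum[OF fin[OF j] primes[OF j]] by simp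
    show "0 \<le> xa a j" unfolding xa_def by (intro prod_nonneg) auto
    show "xa a j \<le> ya a j"
      using bonferroni[OF fin[OF j], of "\<lambda>p. of_bool (p dvd a)" "b j"] even[OF j] unfolding xa_def ya by simp
    show "ya a j \<le> xa a j + ea a j"
      using truncated_product_le_add_elem_sym[OF fin[OF j], of "\<lambda>p. of_bool (p dvd a)" "b j"] even[OF j]
      unfolding xa_def ya ea by simp
  qed
  have xa: "(\<Prod>j<k. xa a j) = of_bool (\<forall>j<k. \<forall>p\<in>Q j. \<not> p dvd a)" for a
  proof (cases "\<forall>j<k. \<forall>p\<in>Q j. \<not> p dvd a")
    case True
    then show ?thesis unfolding xa_def by simp
  next
    case False
    then obtain j p where "j < k" "p \<in> Q j" "p dvd a" by blast
    then have "xa a j = 0" unfolding xa_def using fin by (intro prod_zero) auto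
    then show ?thesis using False \<open>j < k\<close> by (auto intro: prod_zero)
  qed
  have "(\<Sum>a\<in>{u<..w}. \<Prod>j<k. ya a j) - (\<Sum>l<k. \<Sum>a\<in>{u<..w}. \<Prod>j<k. if j = l then ea a j else ya a j)
      = (\<Sum>a\<in>{u<..w}. (\<Prod>j<k. ya a j) - (\<Sum>l<k. \<Prod>j<k. if j = l then ea a j else ya a j))"
    unfolding sum_subtractf by (subst sum.swap) (rule refl)
  also have "\<dots> \<le> (\<Sum>a\<in>{u<..w}. \<Prod>j<k. xa a j)"
    by (intro sum_mono pointwise)
  also have "\<dots> = card {a \<in> {u<..w}. \<forall>j<k. \<forall>p\<in>Q j. \<not> p dvd a}"
    unfolding xa by (simp add: of_bool_def sum.inter_filter[symmetric])
  finally have count: "(\<Sum>a\<in>{u<..w}. \<Prod>j<k. ya a j) - (\<Sum>l<k. \<Sum>a\<in>{u<..w}. \<Prod>j<k. if j = l then ea a j else ya a j)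
      \<le> card {a \<in> {u<..w}. \<forall>j<k. \<forall>p\<in>Q j. \<not> p dvd a}" .
  have "(\<Sum>l<k. \<Sum>a\<in>{u<..w}. \<Prod>j<k. if j = l then ea a j else ya a j)
      \<le> (\<Sum>l<k. (e l / V l) * (\<Prod>j<k. U j) * ?X + (1 + real (card (Q l))) * (\<Prod>j<k. N j))"
    by (intro sum_mono err) auto
  also have "\<dots> = (\<Sum>l<k. e l / V l) * ((\<Prod>j<k. U j) * ?X) + (\<Sum>l<k. 1 + real (card (Q l))) * (\<Prod>j<k. N j)"
    unfolding sum_distrib_right mult.assoc by (rule sum.distrib)
  also have "(\<Sum>l<k. e l / V l) * ((\<Prod>j<k. U j) * ?X) \<le> \<delta> * ((\<Prod>j<k. U j) * ?X)"
  proof (rule mult_right_mono)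
    show "(\<Sum>l<k. e l / V l) \<le> \<delta>" using E unfolding e_def V_def .
    show "0 \<le> (\<Prod>j<k. U j) * ?X" using U \<open>u \<le> w\<close> by (intro mult_nonneg_nonneg prod_nonneg) (auto intro: less_imp_le)
  qed
  finally have "?X * (1 - \<delta>) * (\<Prod>j<k. U j) - (1 + (\<Sum>l<k. 1 + real (card (Q l)))) * (\<Prod>j<k. N j)
      \<le> card {a \<in> {u<..w}. \<forall>j<k. \<forall>p\<in>Q j. \<not> p dvd a}"
    using main count by (simp add: algebra_simps)
  moreover have "?X * (1 - \<delta>) * (\<Prod>j<k. V j) \<le> ?X * (1 - \<delta>) * (\<Prod>j<k. U j)"
    using VU V \<open>\<delta> \<le> 1\<close> \<open>u \<le> w\<close> by (intro mult_left_mono prod_mono) (auto intro: less_imp_le)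
  ultimately show ?thesis unfolding V_def N_def by linarith
qed

section \<open>Integers without small prime factors in an interval\<close>

lemma exp_6_5_le: "exp (6/5 :: real) \<le> 7/2"
proof -
  have "exp (6/5 :: real) = exp (1/10) ^ 12"
    by (simp flip: exp_of_nat_mult)
  also have "exp (1/10 :: real) \<le> 1 + 1/10 + (1/10)\<^sup>2"
    by (rule exp_bound) auto
  then have "exp (1/10 :: real) ^ 12 \<le> (1 + 1/10 + (1/10)\<^sup>2) ^ 12"
    by (rule power_mono) simp
  also have "\<dots> \<le> 7/2"
    by (simp add: power2_eq_square power_divide)
  finally show ?thesis .
qed

text \<open>For \<open>x \<le> 1/100\<close> the bound \<open>- x - 2 * x * x\<close> for
  \<open>ln (1 - x)\<close> is at least \<open>-(51/50) * x\<close>. Then 51/50 * 11/10 < 6/5, whose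
  exponential is at most 7/2.\<close>

lemma prod_one_minus_inverse_ge:
  assumes "finite Q" "\<And>p. p \<in> Q \<Longrightarrow> real p \<ge> 100" "(\<Sum>p\<in>Q. 1 / real p) \<le> 11/10"
  shows "(\<Prod>p\<in>Q. 1 - 1 / real p) \<ge> 2/7"
proof -
  have "exp (-(51/50) * (1 / real p)) \<le> 1 - 1 / real p" if "p \<in> Q" for p
  proof -
    have x: "0 \<le> 1 / real p" "1 / real p \<le> 1/100"
      using assms(2)[OF that] by (auto simp: field_simps)
    have "(1 / real p)\<^sup>2 \<le> (1 / real p) * (1/100)"
      unfolding power2_eq_square by (intro mult_left_mono x)
    then have "-(51/50) * (1 / real p) \<le> - (1 / real p) - 2 * (1 / real p)\<^sup>2" by simp
    also have "\<dots> \<le> ln (1 - 1 / real p)"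
      using x by (intro ln_one_minus_pos_lower_bound) auto
    finally have "exp (-(51/50) * (1 / real p)) \<le> exp (ln (1 - 1 / real p))" by simp
    then show ?thesis using x by simp
  qed
  then have "(\<Prod>p\<in>Q. exp (-(51/50) * (1 / real p))) \<le> (\<Prod>p\<in>Q. 1 - 1 / real p)"
    by (intro prod_mono) auto
  also have "(\<Prod>p\<in>Q. exp (-(51/50) * (1 / real p))) = exp (-(51/50) * (\<Sum>p\<in>Q. 1 / real p))"
    using assms(1) by (simp only: exp_sum sum_distrib_left)
  finally have "exp (-(51/50) * (\<Sum>p\<in>Q. 1 / real p)) \<le> (\<Prod>p\<in>Q. 1 - 1 / real p)" .
  moreover have "exp (-(6/5)) \<le> exp (-(51/50) * (\<Sum>p\<in>Q. 1 / real p))"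
    using assms(3) by simp
  moreover have "2/7 \<le> exp (-(6/5) :: real)"
    using exp_6_5_le by (simp add: exp_minus field_simps)
  ultimately show ?thesis by linarith
qed

text \<open>Here 11/10 bounds the sum of \<open>1 / p\<close> over a range, and
  \<open>2 * j + 3\<close> is the first degree omitted there. The constant 2219/10000 is
  \<open>(11/10) ^ 3 / 6\<close> rounded up; each step multiplies by at most (121/100) / 20 <
  1/16.\<close>

lemma odd_power_over_fact_le: "(11/10 :: real) ^ (2 * j + 3) / fact (2 * j + 3) \<le> 2219/10000 * (1/16) ^ j"
proof (induction j)
  case (Suc j)
  have "(11/10 :: real) ^ (2 * Suc j + 3) / fact (2 * Suc j + 3) =
      ((11/10) ^ (2 * j + 3) / fact (2 * j + 3)) * ((121/100) / ((2 * real j + 5) * (2 * real j + 4)))"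
  proof -
    have "2 * Suc j + 3 = Suc (Suc (2 * j + 3))" by simp
    then have "(fact (2 * Suc j + 3) :: real) = (2 * real j + 5) * ((2 * real j + 4) * fact (2 * j + 3))"
      "(11/10 :: real) ^ (2 * Suc j + 3) = (121/100) * (11/10) ^ (2 * j + 3)"
      by (simp_all only: fact_Suc power_Suc) (simp_all add: algebra_simps)
    moreover have "(x * P) / (a * (b * F)) = (P / F) * (x / (a * b))" for x P a b F :: real
      by (simp add: divide_inverse)
    ultimately show ?thesis by (simp only:)
  qed
  also have "\<dots> \<le> ((11/10) ^ (2 * j + 3) / fact (2 * j + 3)) * (1/16)"
  proof (rule mult_left_mono)
    have "(121/100) / ((2 * real j + 5) * (2 * real j + 4)) \<le> (121/100) / (5 * 4)"
      by (intro divide_left_mono mult_mono) auto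
    also have "\<dots> \<le> 1/16" by simp
    finally show "(121/100) / ((2 * real j + 5) * (2 * real j + 4)) \<le> 1/16" .
  qed simp
  also have "\<dots> \<le> (2219/10000 * (1/16) ^ j) * (1/16)"
    by (intro mult_right_mono Suc.IH) auto
  finally show ?case by simp
qed (simp add: fact_numeral power_divide)

text \<open>The factor 7/2 comes from dividing by the local density, at least 2/7. The geometric
  series gives 7/2 * 0.2219 * 16/15, just below 5/6, so a sixth of the main term survives the
  corrections.\<close>

lemma sum_odd_power_over_fact_le:
  "(\<Sum>j<K. 7/2 * ((11/10 :: real) ^ (2 * j + 3) / fact (2 * j + 3))) \<le> 5/6"
proof -
  have "(\<Sum>j<K. 7/2 * ((11/10 :: real) ^ (2 * j + 3) / fact (2 * j + 3))) \<le> (\<Sum>j<K. 7/2 * (2219/10000 * (1/16) ^ j))"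
    by (intro sum_mono mult_left_mono odd_power_over_fact_le) auto
  also have "\<dots> = 7/2 * (2219/10000) * (\<Sum>j<K. (1/16) ^ j)"
    by (simp add: sum_distrib_left)
  also have "(\<Sum>j<K. (1/16 :: real) ^ j) = (1 - (1/16) ^ K) / (1 - 1/16)"
    by (subst sum_gp_strict) auto
  also have "\<dots> \<le> 1 / (1 - 1/16)" by (intro divide_right_mono) auto
  finally show ?thesis by simp
qed

text \<open>The full series is 2 / (1 - 4/9)^2 = 162/25; the induction carries its tail
  explicitly.\<close>

lemma sum_arith_geometric:
  "(\<Sum>j<K. 2 * (real j + 1) * (4/9) ^ j) \<le> 162/25"
proof -
  have "(\<Sum>j<K. 2 * (real j + 1) * (4/9) ^ j) = 162/25 - (18/5 * real K + 162/25) * (4/9) ^ K"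
  proof (induction K)
    case (Suc K)
    show ?case unfolding sum.lessThan_Suc Suc.IH by (simp add: field_simps)
  qed simp
  then show ?thesis by simp
qed

lemma card_primes_between_le:
  assumes "1 \<le> w"
  shows "1 + real (card (primes_between y w)) \<le> w"
proof -
  have "primes_between y w \<subseteq> {2..nat \<lfloor>w\<rfloor>}"
    using prime_ge_2_nat by (auto simp: primes_between_def le_nat_floor)
  then have "card (primes_between y w) \<le> nat \<lfloor>w\<rfloor> - 1"
    using card_mono[of "{2..nat \<lfloor>w\<rfloor>}"] by force
  moreover have "real (nat \<lfloor>w\<rfloor>) \<le> w" "1 \<le> nat \<lfloor>w\<rfloor>" using assms by linarith+
  ultimately show ?thesis by linarith
qed

text \<open>In the main term 6 is 1 / (1 - 5/6), the squared logarithm bounds the inverse density of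
  the long ranges, and \<open>2 ^ c\<close> that of the bounded primes. In the remainder
  \<open>z powr (162/25)\<close> counts divisors from the truncated ranges; the further
  \<open>ln z * z\<close> pays for the number of ranges and the additional prime in a
  correction.\<close>

lemma sieve_lower_bound:
  defines "c \<equiv> card (primes_between 0 (exp 360))"
  assumes z: "z \<ge> exp 160" and "u \<le> (w :: nat)"
  shows "(real w - real u) / (6 * (ln z)\<^sup>2 * 2 ^ c)
      - (2 + real c) * ln z * z * z powr (162/25) * (1 + real c) ^ (2 * c)
    \<le> card {a \<in> {u<..w}. \<forall>p. prime p \<and> real p \<le> z \<longrightarrow> \<not> p dvd a}"
proof -
  have z1: "z \<ge> 161" using z exp_ge_add_one_self[of 160] by linarith
  have lz: "ln z \<ge> 160" using z z1 by (simp add: ln_ge_iff)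
  define Z where "Z j = z powr ((4/9) ^ j)" for j :: nat
  \<comment> \<open>Cutting stops once the logarithm of the cut point is at most 360. Minimality
    keeps it at least 4/9 * 360 = 160, which makes the error \<open>16 / ln y\<close> of the
    reciprocal sums at most 1/10. All primes below the last cut are bounded by an absolute
    constant.\<close>
  define K where "K = (LEAST K. (4/9) ^ K * ln z \<le> 360)"
  have "\<exists>K. (4/9) ^ K * ln z \<le> 360"
  proof -
    obtain K where "(4/9 :: real) ^ K < 360 / ln z"
      using real_arch_pow_inv[of "360 / ln z" "4/9"] lz by auto
    then have "(4/9) ^ K * ln z \<le> 360" using lz by (simp add: field_simps)
    then show ?thesis ..
  qed
  then have K1: "(4/9) ^ K * ln z \<le> 360" unfolding K_def by (rule LeastI_ex)
  have K2: "160 \<le> (4/9) ^ K * ln z"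
  proof (cases K)
    case (Suc K')
    then have "K' < (LEAST K. (4/9) ^ K * ln z \<le> 360)" by (simp add: K_def)
    then have "\<not> (4/9) ^ K' * ln z \<le> 360" by (rule not_less_Least)
    then have "160 \<le> 4/9 * ((4/9) ^ K' * ln z)" by linarith
    then show ?thesis using Suc by (simp add: mult.assoc)
  qed (use lz in simp)
  have Z_ln: "ln (Z j) = (4/9) ^ j * ln z" for j using z1 by (simp add: Z_def ln_powr)
  have Z_pos: "Z j > 0" for j using z1 by (simp add: Z_def)
  have Z_anti: "Z j \<le> Z i" if "i \<le> j" for i j
    unfolding Z_def using that z1 by (intro powr_mono power_decreasing) auto
  have "exp 160 \<le> Z K" using K2 Z_ln[of K] Z_pos by (metis exp_le_cancel_iff exp_ln)
  then have Z_ge: "exp 160 \<le> Z j" if "j \<le> K" for j using Z_anti[OF that] by linarith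
  have Z_ge': "161 \<le> Z j" if "j \<le> K" for j
    using Z_ge[OF that] exp_ge_add_one_self[of 160] by linarith
  have Z_le: "Z j \<le> z" for j using Z_anti[of 0 j] z1 by (simp add: Z_def)
  have ZK: "Z K \<le> exp 360" using K1 Z_ln[of K] Z_pos by (metis exp_le_cancel_iff exp_ln)
  have Z_Suc: "Z (Suc j) powr (9/4) = Z j" for j by (simp add: Z_def powr_powr)
  define Q where "Q j = (if j < K then primes_between (Z (Suc j)) (Z j) else primes_between 0 (Z K))" for j
  \<comment> \<open>For the bounded primes the order is even and at least their number, so
    inclusion-exclusion is complete there and the omitted term vanishes.\<close>
  define b where "b j = (if j < K then 2 * (j + 1) else 2 * card (Q K))" for j
  have fin: "finite (Q j)" for j by (simp add: Q_def)
  have primes: "prime p" if "p \<in> Q j" for j p using that by (auto simp: Q_def primes_between_def split: if_splits)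
  have "Q K \<subseteq> primes_between 0 (exp 360)" using ZK by (auto simp: Q_def primes_between_def)
  then have QK: "card (Q K) \<le> c" unfolding c_def by (intro card_mono finite_primes_between)
  have sum_inv: "(\<Sum>p\<in>Q j. 1 / real p) \<le> 11/10" if "j < K" for j
  proof -
    have "(\<Sum>p\<in>Q j. 1 / real p) \<le> 1 + 16 / ln (Z (Suc j))"
      using sum_inverse_primes_le_two_step[of "Z (Suc j)"] Z_ge'[of "Suc j"] that by (simp add: Q_def Z_Suc)
    moreover have "ln (Z (Suc j)) \<ge> 160"
      using Z_ge[of "Suc j"] Z_pos that by (simp add: ln_ge_iff)
    then have "16 / ln (Z (Suc j)) \<le> 1/10" by (simp add: field_simps)
    ultimately show ?thesis by linarith
  qed
  have V: "2/7 \<le> (\<Prod>p\<in>Q j. 1 - 1 / real p)" if "j < K" for j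
  proof (rule prod_one_minus_inverse_ge[OF fin _ sum_inv[OF that]])
    fix p assume "p \<in> Q j"
    then show "real p \<ge> 100" using that Z_ge'[of "Suc j"] by (auto simp: Q_def primes_between_def)
  qed
  have VK: "(1/2) ^ c \<le> (\<Prod>p\<in>Q K. 1 - 1 / real p)"
  proof -
    have "(1/2 :: real) ^ c \<le> (1/2) ^ card (Q K)" by (intro power_decreasing QK) auto
    also have "\<dots> = (\<Prod>p\<in>Q K. 1/2)" by simp
    also have "\<dots> \<le> (\<Prod>p\<in>Q K. 1 - 1 / real p)"
    proof (intro prod_mono conjI)
      fix p assume "p \<in> Q K"
      then have "real p \<ge> 2" using prime_ge_2_nat[OF primes] by simp
      then show "1/2 \<le> 1 - 1 / real p" by (simp add: field_simps)
    qed auto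
    finally show ?thesis .
  qed
  have E: "(\<Sum>j<Suc K. elem_sym (Q j) (Suc (b j)) (\<lambda>p. 1 / p) / (\<Prod>p\<in>Q j. 1 - 1 / real p)) \<le> 5/6"
  proof -
    have "{D. D \<subseteq> Q K \<and> card D = Suc (b K)} = {}"
    proof -
      have "card D \<noteq> Suc (b K)" if "D \<subseteq> Q K" for D
        using card_mono[OF fin that] by (simp add: b_def)
      then show ?thesis by blast
    qed
    then have "elem_sym (Q K) (Suc (b K)) (\<lambda>p. 1 / p) = 0" unfolding elem_sym_def by (simp only: sum.empty)
    moreover have "elem_sym (Q j) (Suc (b j)) (\<lambda>p. 1 / p) / (\<Prod>p\<in>Q j. 1 - 1 / real p)
        \<le> 7/2 * ((11/10 :: real) ^ (2 * j + 3) / fact (2 * j + 3))" if "j < K" for j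
    proof -
      have "elem_sym (Q j) (Suc (b j)) (\<lambda>p. 1 / p) \<le> (\<Sum>p\<in>Q j. 1 / real p) ^ (2 * j + 3) / fact (2 * j + 3)"
        using elem_sym_le[OF fin, of j "\<lambda>p. 1 / real p" "2 * j + 3"] that by (simp add: b_def eval_nat_numeral)
      also have "\<dots> \<le> (11/10) ^ (2 * j + 3) / fact (2 * j + 3)"
        by (intro divide_right_mono power_mono sum_inv that sum_nonneg) auto
      finally have "elem_sym (Q j) (Suc (b j)) (\<lambda>p. 1 / p) \<le> (11/10) ^ (2 * j + 3) / fact (2 * j + 3)" .
      then have "elem_sym (Q j) (Suc (b j)) (\<lambda>p. 1 / p) / (\<Prod>p\<in>Q j. 1 - 1 / real p)
          \<le> ((11/10) ^ (2 * j + 3) / fact (2 * j + 3)) / (2/7)"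
        by (intro frac_le V that) auto
      then show ?thesis by simp
    qed
    then have "(\<Sum>j<K. elem_sym (Q j) (Suc (b j)) (\<lambda>p. 1 / p) / (\<Prod>p\<in>Q j. 1 - 1 / real p)) \<le>
        (\<Sum>j<K. 7/2 * ((11/10 :: real) ^ (2 * j + 3) / fact (2 * j + 3)))"
      by (intro sum_mono) auto
    ultimately show ?thesis using sum_odd_power_over_fact_le[of K] by simp
  qed
  have disj: "Q i \<inter> Q j = {}" if "i < j" "j < Suc K" for i j
  proof -
    have "real p \<le> Z j" if "p \<in> Q j" for p
      using that \<open>j < Suc K\<close> by (auto simp: Q_def primes_between_def less_Suc_eq split: if_splits)
    moreover have "Z j < real p" if "p \<in> Q i" for p
      using that \<open>i < j\<close> \<open>j < Suc K\<close> Z_anti[of "Suc i" j] by (auto simp: Q_def primes_between_def)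
    ultimately show ?thesis by force
  qed
  have cover: "{a \<in> {u<..w}. \<forall>j<Suc K. \<forall>p\<in>Q j. \<not> p dvd a} \<subseteq>
      {a \<in> {u<..w}. \<forall>p. prime p \<and> real p \<le> z \<longrightarrow> \<not> p dvd a}"
  proof -
    have "\<exists>j<Suc K. p \<in> Q j" if p: "prime p" "real p \<le> z" for p
    proof (cases "real p \<le> Z K")
      case True
      then have "p \<in> Q K" using p prime_gt_0_nat[OF p(1)] by (simp add: Q_def primes_between_def)
      then show ?thesis by blast
    next
      case False
      \<comment> \<open>The first cut point below \<open>p\<close> is the lower end of the range
        containing \<open>p\<close>.\<close>
      define m where "m = (LEAST m. Z m < real p)"
      have "Z K < real p" using False by simp
      then have m: "Z m < real p" "m \<le> K" unfolding m_def by (rule LeastI, rule Least_le)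
      have "Z 0 = z" using z1 by (simp add: Z_def)
      then have "m \<noteq> 0" using m(1) p by (metis not_le)
      then obtain i where i: "m = Suc i" by (cases m) auto
      then have "i < (LEAST m. Z m < real p)" by (simp add: m_def)
      then have "\<not> Z i < real p" by (rule not_less_Least)
      then have "p \<in> Q i" using m i p by (simp add: Q_def primes_between_def)
      moreover have "i < Suc K" using m(2) i by simp
      ultimately show ?thesis by blast
    qed
    then show ?thesis by blast
  qed
  have K3: "(9/4) ^ K \<le> ln z"
  proof -
    have "(9/4 :: real) ^ K * 1 \<le> (9/4) ^ K * ((4/9) ^ K * ln z)"
      using K2 by (intro mult_left_mono) auto
    also have "\<dots> = ln z" by (simp flip: power_mult_distrib mult.assoc)
    finally show ?thesis by simp
  qed
  have V_prod: "(1 / ln z) ^ 2 * (1/2) ^ c \<le> (\<Prod>j<Suc K. \<Prod>p\<in>Q j. 1 - 1 / real p)"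
  proof -
    \<comment> \<open>Since 7/2 is at most the square of 9/4, and
      \<open>(9/4) ^ K \<le> ln z\<close>, the \<open>K\<close> local densities together lose at
      most a squared logarithm.\<close>
    have "(7/2 :: real) ^ K \<le> ((9/4)\<^sup>2) ^ K" by (intro power_mono) (auto simp: power2_eq_square)
    also have "\<dots> = ((9/4) ^ K)\<^sup>2" by (simp add: power_mult[symmetric] mult.commute)
    also have "\<dots> \<le> (ln z)\<^sup>2" by (intro power_mono K3) auto
    finally have "1 / (ln z)\<^sup>2 \<le> 1 / (7/2) ^ K" by (intro divide_left_mono) (use lz in auto)
    then have "(1 / ln z) ^ 2 \<le> (2/7) ^ K" by (simp add: power_divide)
    also have "(2/7 :: real) ^ K \<le> (\<Prod>j<K. \<Prod>p\<in>Q j. 1 - 1 / real p)"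
      using prod_mono[of "{..<K}" "\<lambda>_. 2/7 :: real" "\<lambda>j. \<Prod>p\<in>Q j. 1 - 1 / real p"] V by simp
    finally have V': "(1 / ln z) ^ 2 \<le> (\<Prod>j<K. \<Prod>p\<in>Q j. 1 - 1 / real p)" .
    then have "0 \<le> (\<Prod>j<K. \<Prod>p\<in>Q j. 1 - 1 / real p)" by (rule order_trans[rotated]) simp
    with V' VK show ?thesis unfolding prod.lessThan_Suc by (intro mult_mono) auto
  qed
  have "(real w - real u) / (6 * (ln z)\<^sup>2 * 2 ^ c) = (real w - real u) * (1 - 5/6) * ((1 / ln z) ^ 2 * (1/2) ^ c)"
    by (simp add: power_divide)
  also have "\<dots> \<le> (real w - real u) * (1 - 5/6) * (\<Prod>j<Suc K. \<Prod>p\<in>Q j. 1 - 1 / real p)"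
    by (rule mult_left_mono[OF V_prod]) (use \<open>u \<le> w\<close> in simp)
  finally have main: "(real w - real u) / (6 * (ln z)\<^sup>2 * 2 ^ c) \<le>
      (real w - real u) * (1 - 5/6) * (\<Prod>j<Suc K. \<Prod>p\<in>Q j. 1 - 1 / real p)" .
  have level: "(\<Prod>j<Suc K. (1 + real (card (Q j))) ^ b j) \<le> z powr (162/25) * (1 + real c) ^ (2 * c)"
  proof -
    have "(\<Prod>j<K. (1 + real (card (Q j))) ^ b j) \<le> (\<Prod>j<K. Z j powr (2 * (real j + 1)))"
    proof (intro prod_mono conjI)
      fix j assume "j \<in> {..<K}"
      then have "1 + real (card (Q j)) \<le> Z j"
        using card_primes_between_le[of "Z j"] Z_ge'[of j] by (simp add: Q_def)
      then have "(1 + real (card (Q j))) ^ b j \<le> Z j ^ b j" by (intro power_mono) auto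
      also have "\<dots> = Z j powr real (b j)" using Z_pos by (simp add: powr_realpow)
      finally show "(1 + real (card (Q j))) ^ b j \<le> Z j powr (2 * (real j + 1))"
        using \<open>j \<in> {..<K}\<close> by (simp add: b_def algebra_simps)
    qed auto
    also have "\<dots> = z powr (\<Sum>j<K. 2 * (real j + 1) * (4/9) ^ j)"
      using z1 by (simp add: Z_def powr_powr powr_sum mult_ac)
    also have "\<dots> \<le> z powr (162/25)"
      using z1 by (intro powr_mono sum_arith_geometric) auto
    finally have 1: "(\<Prod>j<K. (1 + real (card (Q j))) ^ b j) \<le> z powr (162/25)" .
    have "(1 + card (Q K)) ^ b K \<le> (1 + c) ^ b K"
      using QK by (intro power_mono) auto
    also have "\<dots> \<le> (1 + c) ^ (2 * c)"
      using QK by (intro power_increasing) (auto simp: b_def)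
    finally have "real ((1 + card (Q K)) ^ b K) \<le> real ((1 + c) ^ (2 * c))" by (rule of_nat_mono)
    then have "(1 + real (card (Q K))) ^ b K \<le> (1 + real c) ^ (2 * c)" by simp
    with 1 have "(\<Prod>j<K. (1 + real (card (Q j))) ^ b j) * (1 + real (card (Q K))) ^ b K
        \<le> z powr (162/25) * (1 + real c) ^ (2 * c)"
      by (rule mult_mono) auto
    then show ?thesis by simp
  qed
  have ranges: "1 + (\<Sum>l<Suc K. 1 + real (card (Q l))) \<le> (2 + real c) * ln z * z"
  proof -
    have "(\<Sum>l<K. 1 + real (card (Q l))) \<le> (\<Sum>l<K. z)"
    proof (rule sum_mono)
      fix l assume "l \<in> {..<K}"
      then have "1 + real (card (Q l)) \<le> Z l"
        using card_primes_between_le[of "Z l"] Z_ge'[of l] by (simp add: Q_def)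
      then show "1 + real (card (Q l)) \<le> z" using Z_le[of l] by linarith
    qed
    then have "1 + (\<Sum>l<Suc K. 1 + real (card (Q l))) \<le> 2 + real c + real K * z"
      using QK by simp
    also have "\<dots> \<le> (2 + real c) * z + (2 + real c) * (real K * z)"
      using z1 by (intro add_mono) (auto intro: mult_right_mono[of 1 "2 + real c" "real K * z", simplified] simp: mult_le_cancel_left1)
    also have "\<dots> = (2 + real c) * (real K + 1) * z" by (simp add: algebra_simps)
    also have "real K + 1 \<le> ln z"
    proof -
      have "real (Suc K) \<le> real (2 ^ K)" by (intro of_nat_mono) (simp add: Suc_leI)
      also have "\<dots> \<le> (9/4) ^ K" unfolding of_nat_power by (intro power_mono) auto
      finally show ?thesis using K3 by simp
    qed
    finally show ?thesis using z1 by (simp add: mult_right_mono mult_left_mono)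
  qed
  have "(1 + (\<Sum>l<Suc K. 1 + real (card (Q l)))) * (\<Prod>j<Suc K. (1 + real (card (Q j))) ^ b j)
      \<le> ((2 + real c) * ln z * z) * (z powr (162/25) * (1 + real c) ^ (2 * c))"
    by (intro mult_mono ranges level prod_nonneg mult_nonneg_nonneg) (use lz z1 in auto)
  moreover have "(real w - real u) * (1 - 5/6) * (\<Prod>j<Suc K. \<Prod>p\<in>Q j. 1 - 1 / real p)
      - (1 + (\<Sum>l<Suc K. 1 + real (card (Q l)))) * (\<Prod>j<Suc K. (1 + real (card (Q j))) ^ b j)
    \<le> card {a \<in> {u<..w}. \<forall>j<Suc K. \<forall>p\<in>Q j. \<not> p dvd a}"
    by (rule brun_hooley[OF primes fin disj _ E _ \<open>u \<le> w\<close>]) (auto simp: b_def)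
  moreover have "real (card {a \<in> {u<..w}. \<forall>j<Suc K. \<forall>p\<in>Q j. \<not> p dvd a})
      \<le> card {a \<in> {u<..w}. \<forall>p. prime p \<and> real p \<le> z \<longrightarrow> \<not> p dvd a}"
    by (intro of_nat_mono card_mono cover) auto
  ultimately show ?thesis using main unfolding mult.assoc by linarith
qed

section \<open>Rough integers in short intervals\<close>

theorem ex_rough_in_interval:
  "\<exists>z0. \<forall>z\<ge>z0. \<forall>u w :: nat. z powr 8 \<le> real w - real u \<longrightarrow>
     (\<exists>t\<in>{u<..w}. \<forall>p. prime p \<longrightarrow> p dvd t \<longrightarrow> z < real p)"
proof -
  define c where "c = card (primes_between 0 (exp 360))"
  define A where "A = (2 + real c) * (1 + real c) ^ (2 * c)"
  define B :: real where "B = 6 * 2 ^ c"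
  \<comment> \<open>The exponent 8 exceeds 1 + 162/25 = 7.48. Two of the three logarithms come from
    the density in the main term, the third from the remainder.\<close>
  have "\<forall>\<^sub>F z in at_top. B * (A * ln z ^ 3 * z * z powr (162/25)) < z powr 8"
  proof -
    have "A > 0" "B > 0" by (simp_all add: A_def B_def add_pos_nonneg)
    then show ?thesis by real_asymp
  qed
  then obtain z0 where z0: "\<And>z. z \<ge> z0 \<Longrightarrow> B * (A * ln z ^ 3 * z * z powr (162/25)) < z powr 8"
    by (auto simp: eventually_at_top_linorder)
  have "\<exists>t\<in>{u<..w}. \<forall>p. prime p \<longrightarrow> p dvd t \<longrightarrow> z < real p"
    if z: "z \<ge> max z0 (exp 160)" and uw: "z powr 8 \<le> real w - real u" for z and u w :: nat
  proof -
    have "ln z > 0" using z exp_ge_add_one_self[of 160] by (intro ln_gt_zero) linarith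
    have "u \<le> w" using uw powr_ge_zero[of z 8] by linarith
    have "B * (A * ln z ^ 3 * z * z powr (162/25)) < real w - real u" using z0[of z] z uw by simp
    then have "A * ln z * z * z powr (162/25) < (real w - real u) / (B * (ln z)\<^sup>2)"
      using \<open>ln z > 0\<close> by (simp add: B_def field_simps power2_eq_square power3_eq_cube)
    then have "0 < (real w - real u) / (6 * (ln z)\<^sup>2 * 2 ^ c)
      - (2 + real c) * ln z * z * z powr (162/25) * (1 + real c) ^ (2 * c)"
      by (simp add: A_def B_def mult_ac)
    also have "\<dots> \<le> card {a \<in> {u<..w}. \<forall>p. prime p \<and> real p \<le> z \<longrightarrow> \<not> p dvd a}"
      using sieve_lower_bound[of z u w] z \<open>u \<le> w\<close> unfolding c_def by simp
    finally have "card {a \<in> {u<..w}. \<forall>p. prime p \<and> real p \<le> z \<longrightarrow> \<not> p dvd a} > 0"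
      by (simp only: of_nat_0_less_iff)
    then obtain t where "t \<in> {u<..w}" "\<forall>p. prime p \<and> real p \<le> z \<longrightarrow> \<not> p dvd t"
      unfolding card_gt_0_iff by blast
    then show ?thesis by (meson not_le)
  qed
  then show ?thesis by blast
qed

text \<open>The interval for \<open>t\<close> has length at least
  \<open>n / (q ^ 2 * (q ^ 2 + 1)) - 1\<close>. Together with
  \<open>q ^ 2 + 1 \<le> 2 * q ^ 2\<close>, the bound \<open>4 * q ^ 12 \<le> n\<close> makes this
  at least \<open>2 * q ^ 8 - 1\<close>, hence at least \<open>q ^ 8\<close>.\<close>

lemma ex_rough_quotient:
  "\<exists>z0. \<forall>q n :: nat. z0 \<le> real q \<and> 0 < q \<and> 4 * real q ^ 12 \<le> real n \<longrightarrow>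
     (\<exists>t>0. q * q * t \<le> n \<and> n \<le> q * q * t + t \<and> (\<forall>p. prime p \<longrightarrow> p dvd t \<longrightarrow> q < p))"
proof -
  obtain z0 where z0: "\<And>z u w. z \<ge> z0 \<Longrightarrow> z powr 8 \<le> real w - real u \<Longrightarrow>
     \<exists>t\<in>{u<..w}. \<forall>p. prime p \<longrightarrow> p dvd t \<longrightarrow> z < real p"
    using ex_rough_in_interval by blast
  have "\<exists>t>0. q * q * t \<le> n \<and> n \<le> q * q * t + t \<and> (\<forall>p. prime p \<longrightarrow> p dvd t \<longrightarrow> q < p)"
    if q: "z0 \<le> real q" "0 < q" and n: "4 * real q ^ 12 \<le> real n" for q n :: nat
  proof -
    \<comment> \<open>Above \<open>u\<close> means \<open>n < t * (q * q + 1)\<close>, so that the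
      leftover \<open>n - q * q * t\<close> is below \<open>t\<close>; at most \<open>w\<close>
      means \<open>q * q * t \<le> n\<close>.\<close>
    define u where "u = n div (q * q + 1)"
    define w where "w = n div (q * q)"
    have q1: "1 \<le> real q" using q(2) by simp
    have "real n / (real q ^ 2 + 1) \<ge> real u"
      using of_nat_div_le_of_nat[of n "q * q + 1", where ?'a = real] by (simp add: u_def power2_eq_square add.commute)
    moreover have "real n / real q ^ 2 - 1 \<le> real w"
      using floor_divide_of_nat_eq[of n "q * q", where ?'a = real] floor_correct[of "real n / real (q * q)"]
      by (simp add: w_def power2_eq_square)
    ultimately have "real n / real q ^ 2 - real n / (real q ^ 2 + 1) - 1 \<le> real w - real u" by linarith
    moreover have "real n / real q ^ 2 - real n / (real q ^ 2 + 1) = real n / (real q ^ 2 * (real q ^ 2 + 1))"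
    proof -
      have "N / A - N / (A + 1) = N / (A * (A + 1))" if "A > 0" for N A :: real
        using that by (subst diff_frac_eq) (auto simp: algebra_simps)
      then show ?thesis using q1 by simp
    qed
    moreover have "2 * real q ^ 8 \<le> real n / (real q ^ 2 * (real q ^ 2 + 1))"
    proof -
      have "real q ^ 2 * (real q ^ 2 + 1) \<le> real q ^ 2 * (2 * real q ^ 2)"
        using one_le_power[OF q1, of 2] by (intro mult_left_mono) auto
      then have "2 * real q ^ 8 * (real q ^ 2 * (real q ^ 2 + 1)) \<le> 2 * real q ^ 8 * (real q ^ 2 * (2 * real q ^ 2))"
        by (rule mult_left_mono) simp
      also have "\<dots> = 4 * real q ^ 12" by (simp flip: power_add)
      finally have "2 * real q ^ 8 * (real q ^ 2 * (real q ^ 2 + 1)) \<le> real n" using n by linarith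
      then show ?thesis using q1 by (simp add: pos_le_divide_eq add_pos_pos)
    qed
    moreover have "1 \<le> real q ^ 8" using q1 by (rule one_le_power)
    moreover have "real q powr 8 = real q ^ 8" using q1 powr_realpow[of "real q" 8] by simp
    ultimately have "real q powr 8 \<le> real w - real u" by linarith
    then obtain t where t: "u < t" "t \<le> w" "\<And>p. prime p \<Longrightarrow> p dvd t \<Longrightarrow> real q < real p"
      using z0[OF q(1)] by (metis greaterThanAtMost_iff)
    have "n < t * (q * q + 1)" using t(1) unfolding u_def by (simp add: div_less_iff_less_mult)
    moreover have "t * (q * q) \<le> n" using t(2) q(2) unfolding w_def by (simp add: less_eq_div_iff_mult_less_eq)
    ultimately show ?thesis
      using t by (intro exI[of _ t]) (auto simp: algebra_simps)
  qed
  then show ?thesis by blast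
qed

theorem theorem1p1:
  shows "\<exists>n0::nat. \<forall>n::nat. n \<ge> n0 \<longrightarrow>
           real (max_code_size n (n - 1)) \<ge> real n powr 1.0797"
proof -
  obtain z0 where z0: "\<And>q n :: nat. z0 \<le> real q \<Longrightarrow> 0 < q \<Longrightarrow> 4 * real q ^ 12 \<le> real n \<Longrightarrow>
     \<exists>t>0. q * q * t \<le> n \<and> n \<le> q * q * t + t \<and> (\<forall>p. prime p \<longrightarrow> p dvd t \<longrightarrow> q < p)"
    using ex_rough_quotient by blast
  have "\<forall>\<^sub>F x in at_top. z0 \<le> x powr (8/100)" by real_asymp
  \<comment> \<open>The difference of the logarithms is \<open>3/1000 * ln x\<close>, which
    eventually exceeds the 8 of Mertens' theorem.\<close>
  moreover have "\<forall>\<^sub>F x::real in at_top. ln (x powr (83/1000)) > ln (x powr (8/100)) + 8" by real_asymp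
  \<comment> \<open>Here 12 * 83/1000 = 0.996 < 1.\<close>
  moreover have "\<forall>\<^sub>F x::real in at_top. 4 * (x powr (83/1000)) ^ 12 \<le> x" by real_asymp
  \<comment> \<open>The code size has order at least \<open>x powr 1.08\<close>. The slack down to
    1.0797 absorbs the subtracted 2 and the halving, which comes from
    \<open>n \<le> 2 * (q * q * t)\<close>.\<close>
  moreover have "\<forall>\<^sub>F x::real in at_top. x powr (10797/10000) \<le> (x powr (8/100) - 2) * (x / 2)" by real_asymp
  ultimately have "\<forall>\<^sub>F x in at_top. 1 \<le> x \<and> z0 \<le> x powr (8/100) \<and>
      ln (x powr (83/1000)) > ln (x powr (8/100)) + 8 \<and> 4 * (x powr (83/1000)) ^ 12 \<le> x \<and>
      x powr (10797/10000) \<le> (x powr (8/100) - 2) * (x / 2)"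
    by (intro eventually_conj eventually_ge_at_top)
  then obtain x0 :: real where x0: "\<And>x. x \<ge> x0 \<Longrightarrow> 1 \<le> x \<and> z0 \<le> x powr (8/100) \<and>
      ln (x powr (83/1000)) > ln (x powr (8/100)) + 8 \<and> 4 * (x powr (83/1000)) ^ 12 \<le> x \<and>
      x powr (10797/10000) \<le> (x powr (8/100) - 2) * (x / 2)"
    by (auto simp: eventually_at_top_linorder)
  have "real n powr 1.0797 \<le> real (max_code_size n (n - 1))" if "n \<ge> nat \<lceil>x0\<rceil>" for n
  proof -
    have "real n \<ge> x0" using that by linarith
    note n = x0[OF this]
    define y where "y = real n powr (8/100)"
    have "1 \<le> y" using n by (simp add: y_def ge_one_powr_ge_zero)
    moreover have "y \<le> real n powr (83/1000)" unfolding y_def using n by (intro powr_mono) auto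
    ultimately obtain q where q: "prime q" "y < real q" "real q \<le> real n powr (83/1000)"
      using ex_prime_between[of y "real n powr (83/1000)"] n unfolding y_def by blast
    have "4 * real q ^ 12 \<le> 4 * (real n powr (83/1000)) ^ 12"
      using q(3) by (intro mult_left_mono power_mono) auto
    then have "4 * real q ^ 12 \<le> real n" using n by linarith
    moreover have "z0 \<le> real q" using n q(2) unfolding y_def by linarith
    ultimately obtain t where t: "t > 0" "q * q * t \<le> n" "n \<le> q * q * t + t" "\<And>p. prime p \<Longrightarrow> p dvd t \<Longrightarrow> q < p"
      using z0[of q n] prime_gt_0_nat[OF q(1)] by blast
    have "real n powr 1.0797 \<le> (y - 2) * (real n / 2)" using n by (simp add: y_def)
    also have "\<dots> \<le> real (q - 2) * real (q * q * t)"
    proof (rule mult_mono)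
      show "y - 2 \<le> real (q - 2)" using q(2) by linarith
      have "1 * t \<le> q * q * t" using prime_gt_0_nat[OF q(1)] by (intro mult_right_mono) auto
      then have "n \<le> 2 * (q * q * t)" using t(3) by linarith
      then have "real n \<le> real (2 * (q * q * t))" by (rule of_nat_mono)
      then show "real n / 2 \<le> real (q * q * t)" by simp
    qed auto
    also have "\<dots> \<le> real (max_code_size n (n - 1))"
      using max_code_size_ge_of_rough[OF q(1) t(1,4), of "n - q * q * t"] t(2,3)
      by (simp flip: of_nat_mult)
    finally show ?thesis .
  qed
  then show ?thesis by blast
qed

end
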